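(* The set of $F(U)$-bimodules with compatible $\mathrm{ad}\,U$-module action can be identified with the set of $F(U\otimes U^{op})\psi(U)$-modules.
   Context: $\mathfrak g$ is a complex semisimple Lie algebra with simple roots $\pi=\{\alpha_1,\dots,\alpha_n\}$, Cartan inner product $(\ ,\ )$, and $a_{ij}=2(\alpha_i,\alpha_j)/(\alpha_i,\alpha_i)$. $q$ is an indeterminate, $q_i=q^{(\alpha_i,\alpha_i)/2}$. $U=U_q(\mathfrak g)$ is the $\mathbf C(q)$-algebra generated by $x_i,y_i,t_i^{\pm1}$ ($1\le i\le n$) with relations: $x_iy_j-y_jx_i=\delta_{ij}(t_i-t_i^{-1})/(q_i-q_i^{-1})$; the $t_i^{\pm1}$ generate a free abelian group $T$ of rank $n$; $t_ix_j=q^{(\alpha_i,\alpha_j)}x_jt_i$, $t_iy_j=q^{-(\alpha_i,\alpha_j)}y_jt_i$; and the quantum Serre relations $\sum_{m=0}^{1-a_{ij}}(-1)^m\binom{1-a_{ij}}{m}_{q_i}z_i^{1-a_{ij}-m}z_jz_i^m=0$ for $i\ne j$, for $z=x$ and $z=y$ (symmetric $q$-binomials). It is a Hopf algebra with $\Delta(t)=t\otimes t$, $\epsilon(t)=1$, $\sigma(t)=t^{-1}$ ($t\in T$); $\Delta(x_i)=x_i\otimes1+t_i\otimes x_i$, $\epsilon(x_i)=0$, $\sigma(x_i)=-t_i^{-1}x_i$; $\Delta(y_i)=y_i\otimes t_i^{-1}+1\otimes y_i$, $\epsilon(y_i)=0$, $\sigma(y_i)=-y_it_i$. For a Hopf algebra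 $H$ with antipode $\sigma$, $(\mathrm{ad}\,a)b=\sum a_{(1)}b\sigma(a_{(2)})$ and $F(H)=\{v\in H:\dim(\mathrm{ad}\,H)v<\infty\}$. $U^{op}$ is the Hopf algebra with underlying vector space $U$, opposite multiplication, the same comultiplication and counit, and antipode $\sigma^{-1}$; $U\otimes U^{op}$ is the tensor product Hopf algebra. One has $F(U\otimes U^{op})=F(U)\otimes F(U)^{op}$. The algebra embedding $\psi:U\to U\otimes U^{op}$ is $\psi(u)=\sum u_{(1)}\otimes\sigma(u_{(2)})$; $\psi(U)$ is a left coideal subalgebra of $U\otimes U^{op}$, so $F(U\otimes U^{op})\psi(U)=\psi(U)F(U\otimes U^{op})$ is a subalgebra of $U\otimes U^{op}$. An $F(U)$-bimodule $M$ has a compatible $\mathrm{ad}\,U$-module action if it carries a left $U$-module structure, written $(\mathrm{ad}\,a)m$, such that $(\mathrm{ad}\,a)(b\cdot m\cdot c)=\sum\big((\mathrm{ad}\,a_{(1)})b\big)\cdot\big((\mathrm{ad}\,a_{(2)})m\big)\cdot\big((\mathrm{ad}\,a_{(3)})c\big)$ for all $a\in U$, $b,c\in F(U)$, $m\in M$, and $\sum\big((\mathrm{ad}\,a_{(1)})m\big)\cdot a_{(2)}=a\cdot m$ for all $a\in F(U)$, $m\in M$ (here $\Delta(F(U))\subset U\otimes F(U)$). *)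

theory Defs
  imports
    Complex_Main
    "HOL-Library.Poly_Mapping"
    "HOL-Library.FuncSet"
    "HOL-Computational_Algebra.Polynomial"
    "HOL-Computational_Algebra.Fraction_Field"
begin

type_synonym ratfun = "complex poly fract"

definition qvar :: ratfun where
  "qvar = Fract [:0, 1:] 1"

class scaleq =
  fixes scaleq :: "ratfun \<Rightarrow> 'a \<Rightarrow> 'a" (infixr \<open>*\<^sub>q\<close> 75)

class cq_vector = scaleq + ab_group_add +
  assumes scaleq_right_distrib: "a *\<^sub>q (x + y) = a *\<^sub>q x + a *\<^sub>q y"
    and scaleq_left_distrib: "(a + b) *\<^sub>q x = a *\<^sub>q x + b *\<^sub>q x"
    and scaleq_scaleq: "a *\<^sub>q b *\<^sub>q x = (a * b) *\<^sub>q x"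
    and scaleq_one: "1 *\<^sub>q x = x"

global_interpretation cq: vector_space "scaleq :: ratfun \<Rightarrow> 'a \<Rightarrow> 'a::cq_vector"
  by standard (simp_all add: scaleq_right_distrib scaleq_left_distrib scaleq_scaleq scaleq_one)

class cq_algebra = cq_vector + ring_1 +
  assumes mult_scaleq_left: "(a *\<^sub>q x) * y = a *\<^sub>q (x * y)"
    and mult_scaleq_right: "x * (a *\<^sub>q y) = a *\<^sub>q (x * y)"

definition cq_linear :: "('a::cq_vector \<Rightarrow> 'b::cq_vector) \<Rightarrow> bool" where
  "cq_linear f \<longleftrightarrow> (\<forall>x y. f (x + y) = f x + f y) \<and> (\<forall>c x. f (c *\<^sub>q x) = c *\<^sub>q f x)"

definition cq_algebra_hom :: "('a::cq_algebra \<Rightarrow> 'b::cq_algebra) \<Rightarrow> bool" where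
  "cq_algebra_hom f \<longleftrightarrow> cq_linear f \<and> f 1 = 1 \<and> (\<forall>x y. f (x * y) = f x * f y)"

lemma cq_linearD:
  assumes "cq_linear f"
  shows "f (x + y) = f x + f y" "f (c *\<^sub>q x) = c *\<^sub>q f x" "f 0 = 0" "f (- x) = - f x"
    "f (x - y) = f x - f y"
proof -
  show a: "f (x + y) = f x + f y" "f (c *\<^sub>q x) = c *\<^sub>q f x" for x y c
    using assms by (auto simp: cq_linear_def)
  show z: "f 0 = 0" using a(1)[of 0 0] by simp
  show m: "f (- x) = - f x" for x using a(1)[of x "- x"] z by (simp add: eq_neg_iff_add_eq_0 add.commute)
  show "f (x - y) = f x - f y" using a(1)[of x "- y"] m by simp
qed

definition free_scale :: "ratfun \<Rightarrow> ('x \<Rightarrow>\<^sub>0 ratfun) \<Rightarrow> ('x \<Rightarrow>\<^sub>0 ratfun)" where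
  "free_scale c = Poly_Mapping.map ((*) c)"

lemma lookup_free_scale [simp]:
  "Poly_Mapping.lookup (free_scale c f) x = c * Poly_Mapping.lookup f x"
  unfolding free_scale_def by transfer (simp add: when_def)

lemma vector_space_free_scale: "vector_space free_scale"
  by standard (auto intro!: poly_mapping_eqI simp: lookup_add algebra_simps)

definition lin_ext :: "('x \<Rightarrow> 'a::cq_vector) \<Rightarrow> ('x \<Rightarrow>\<^sub>0 ratfun) \<Rightarrow> 'a" where
  "lin_ext f p = (\<Sum>x\<in>Poly_Mapping.keys p. Poly_Mapping.lookup p x *\<^sub>q f x)"

lemma lin_ext_superset:
  assumes "finite S" "Poly_Mapping.keys p \<subseteq> S"
  shows "lin_ext f p = (\<Sum>x\<in>S. Poly_Mapping.lookup p x *\<^sub>q f x)"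
  unfolding lin_ext_def using assms
  by (intro sum.mono_neutral_left) (auto simp: in_keys_iff)

lemma lin_ext_add: "lin_ext f (p + r) = lin_ext f p + lin_ext f r"
proof -
  let ?S = "Poly_Mapping.keys p \<union> Poly_Mapping.keys r"
  have "Poly_Mapping.keys (p + r) \<subseteq> ?S" by (rule Poly_Mapping.keys_add)
  then show ?thesis
    by (subst (1 2 3) lin_ext_superset[where S = ?S])
      (auto simp: lookup_add cq.scale_left_distrib sum.distrib)
qed

lemma lin_ext_scale: "lin_ext f (free_scale c p) = c *\<^sub>q lin_ext f p"
proof -
  let ?S = "Poly_Mapping.keys p"
  have "Poly_Mapping.keys (free_scale c p) \<subseteq> ?S" by (auto simp: in_keys_iff)
  then show ?thesis
    by (subst (1 2) lin_ext_superset[where S = ?S])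
      (auto simp: cq.scale_sum_right)
qed

lemma lin_ext_zero [simp]: "lin_ext f 0 = 0"
  by (simp add: lin_ext_def)

lemma lin_ext_diff: "lin_ext f (p - r) = lin_ext f p - lin_ext f r"
  using lin_ext_add[of f "p - r" r] by simp

lemma lin_ext_single [simp]: "lin_ext f (Poly_Mapping.single x c) = c *\<^sub>q f x"
  by (simp add: lin_ext_def)

definition tensor_relators ::
    "(('a::cq_vector \<times> 'b::cq_vector) \<Rightarrow>\<^sub>0 ratfun) set" where
  "tensor_relators =
     (let e = (\<lambda>a b. Poly_Mapping.single (a, b) (1::ratfun)) in
       {e (a + a') b - e a b - e a' b | a a' b. True} \<union>
       {e a (b + b') - e a b - e a b' | a b b'. True} \<union>
       {e (c *\<^sub>q a) b - free_scale c (e a b) | a b c. True} \<union>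
       {e a (c *\<^sub>q b) - free_scale c (e a b) | a b c. True})"

definition tensor_null ::
    "(('a::cq_vector \<times> 'b::cq_vector) \<Rightarrow>\<^sub>0 ratfun) set" where
  "tensor_null = module.span free_scale tensor_relators"

lemma module_free_scale: "module free_scale"
  using vector_space_free_scale by (simp add: module_iff_vector_space)

lemma subspace_tensor_null: "module.subspace free_scale tensor_null"
  unfolding tensor_null_def by (rule module.subspace_span[OF module_free_scale])

lemmas tensor_null_zero = module.subspace_0[OF module_free_scale subspace_tensor_null]
  and tensor_null_add = module.subspace_add[OF module_free_scale subspace_tensor_null]
  and tensor_null_diff = module.subspace_diff[OF module_free_scale subspace_tensor_null]
  and tensor_null_neg = module.subspace_neg[OF module_free_scale subspace_tensor_null]
  and tensor_null_scale = module.subspace_scale[OF module_free_scale subspace_tensor_null]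

lemma tensor_null_relator: "z \<in> tensor_relators \<Longrightarrow> z \<in> tensor_null"
  unfolding tensor_null_def by (rule module.span_base[OF module_free_scale])

quotient_type (overloaded) ('a, 'b) tensor =
    "(('a::cq_vector \<times> 'b::cq_vector) \<Rightarrow>\<^sub>0 ratfun)" / "\<lambda>z w. z - w \<in> tensor_null"
proof (rule equivpI)
  show "reflp (\<lambda>z w. z - w \<in> (tensor_null :: (('a \<times> 'b) \<Rightarrow>\<^sub>0 ratfun) set))"
    by (rule reflpI) (simp add: tensor_null_zero)
  show "symp (\<lambda>z w. z - w \<in> (tensor_null :: (('a \<times> 'b) \<Rightarrow>\<^sub>0 ratfun) set))"
    by (rule sympI) (metis tensor_null_neg minus_diff_eq)
  show "transp (\<lambda>z w. z - w \<in> (tensor_null :: (('a \<times> 'b) \<Rightarrow>\<^sub>0 ratfun) set))"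
  proof (rule transpI)
    fix x y z :: "('a \<times> 'b) \<Rightarrow>\<^sub>0 ratfun"
    assume "x - y \<in> tensor_null" "y - z \<in> tensor_null"
    from tensor_null_add[OF this] show "x - z \<in> tensor_null" by simp
  qed
qed

instantiation tensor :: (cq_vector, cq_vector) cq_vector
begin

lift_definition zero_tensor :: "('a, 'b) tensor" is 0 .

lift_definition plus_tensor :: "('a, 'b) tensor \<Rightarrow> ('a, 'b) tensor \<Rightarrow> ('a, 'b) tensor" is "(+)"
  by (metis add_diff_add tensor_null_add)

lift_definition minus_tensor :: "('a, 'b) tensor \<Rightarrow> ('a, 'b) tensor \<Rightarrow> ('a, 'b) tensor" is "(-)"
proof -
  fix a b c d :: "('a \<times> 'b) \<Rightarrow>\<^sub>0 ratfun"
  assume "a - b \<in> tensor_null" "c - d \<in> tensor_null"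
  from tensor_null_diff[OF this] show "(a - c) - (b - d) \<in> tensor_null"
    by (simp add: algebra_simps)
qed

lift_definition uminus_tensor :: "('a, 'b) tensor \<Rightarrow> ('a, 'b) tensor" is uminus
proof -
  fix a b :: "('a \<times> 'b) \<Rightarrow>\<^sub>0 ratfun"
  assume "a - b \<in> tensor_null"
  from tensor_null_neg[OF this] show "- a - - b \<in> tensor_null" by simp
qed

lift_definition scaleq_tensor :: "ratfun \<Rightarrow> ('a, 'b) tensor \<Rightarrow> ('a, 'b) tensor" is free_scale
proof -
  fix c and a b :: "('a \<times> 'b) \<Rightarrow>\<^sub>0 ratfun"
  assume "a - b \<in> tensor_null"
  from tensor_null_scale[OF this, of c] show "free_scale c a - free_scale c b \<in> tensor_null"
    by (simp add: module.scale_right_diff_distrib[OF module_free_scale])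
qed

instance
proof
  fix x y z :: "('a, 'b) tensor" and c d :: ratfun
  show "x + y + z = x + (y + z)" by transfer (simp add: tensor_null_zero add.assoc)
  show "x + y = y + x" by transfer (simp add: tensor_null_zero add.commute)
  show "0 + x = x" by transfer (simp add: tensor_null_zero)
  show "- x + x = 0" by transfer (simp add: tensor_null_zero)
  show "x - y = x + - y" by transfer (simp add: tensor_null_zero)
  show "c *\<^sub>q (x + y) = c *\<^sub>q x + c *\<^sub>q y"
    by transfer (simp add: tensor_null_zero module.scale_right_distrib[OF module_free_scale])
  show "(c + d) *\<^sub>q x = c *\<^sub>q x + d *\<^sub>q x"
    by transfer (simp add: tensor_null_zero module.scale_left_distrib[OF module_free_scale])
  show "c *\<^sub>q d *\<^sub>q x = (c * d) *\<^sub>q x"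
    by transfer (simp add: tensor_null_zero module.scale_scale[OF module_free_scale])
  show "1 *\<^sub>q x = x"
    by transfer (simp add: tensor_null_zero module.scale_one[OF module_free_scale])
qed

end

lift_definition tens :: "'a::cq_vector \<Rightarrow> 'b::cq_vector \<Rightarrow> ('a, 'b) tensor" (infixl \<open>\<otimes>\<close> 70)
  is "\<lambda>a b. Poly_Mapping.single (a, b) 1" .

lemma tens_add_left: "(a + a') \<otimes> b = a \<otimes> b + a' \<otimes> b"
  by transfer (rule tensor_null_relator, auto simp: tensor_relators_def Let_def diff_diff_eq, blast)

lemma tens_add_right: "a \<otimes> (b + b') = a \<otimes> b + a \<otimes> b'"
  by transfer (rule tensor_null_relator, auto simp: tensor_relators_def Let_def diff_diff_eq, blast)

lemma tens_scale_left: "(c *\<^sub>q a) \<otimes> b = c *\<^sub>q (a \<otimes> b)"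
  by transfer (rule tensor_null_relator, auto simp: tensor_relators_def Let_def)

lemma tens_scale_right: "a \<otimes> (c *\<^sub>q b) = c *\<^sub>q (a \<otimes> b)"
  by transfer (rule tensor_null_relator, unfold tensor_relators_def Let_def, blast)

definition cq_bilinear :: "('a::cq_vector \<Rightarrow> 'b::cq_vector \<Rightarrow> 'c::cq_vector) \<Rightarrow> bool" where
  "cq_bilinear f \<longleftrightarrow> (\<forall>b. cq_linear (\<lambda>a. f a b)) \<and> (\<forall>a. cq_linear (f a))"

lemma cq_bilinear_tens: "cq_bilinear (\<otimes>)"
  by (auto simp: cq_bilinear_def cq_linear_def tens_add_left tens_add_right
      tens_scale_left tens_scale_right)

text \<open>For bilinear f, tlift f sends a sum of pure tensors a \<otimes> b to the sum of the f a b, that is,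
  tlift f (\<Delta> u) is the Sweedler sum of f u(1) u(2).
  For other f its value depends on the choice of representative.\<close>

definition tlift :: "('a::cq_vector \<Rightarrow> 'b::cq_vector \<Rightarrow> 'c::cq_vector) \<Rightarrow> ('a, 'b) tensor \<Rightarrow> 'c" where
  "tlift f z = lin_ext (\<lambda>(a, b). f a b) (rep_tensor z)"

lemma lin_ext_tensor_null:
  assumes f: "cq_bilinear f" and z: "z \<in> tensor_null"
  shows "lin_ext (\<lambda>(a, b). f a b) z = 0"
  using z unfolding tensor_null_def
proof (rule module.span_induct[OF module_free_scale])
  show "module.subspace free_scale {z. lin_ext (\<lambda>(a, b). f a b) z = 0}"
    by (simp add: module.subspace_def[OF module_free_scale] lin_ext_add lin_ext_scale)
next
  fix w :: "('a \<times> 'b) \<Rightarrow>\<^sub>0 ratfun"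
  assume "w \<in> tensor_relators"
  moreover have "cq_linear (\<lambda>a. f a b)" "cq_linear (f a)" for a b
    using f by (auto simp: cq_bilinear_def)
  note lin = cq_linearD[OF this(1)] cq_linearD[OF this(2)]
  ultimately show "lin_ext (\<lambda>(a, b). f a b) w = 0"
    by (auto simp: tensor_relators_def Let_def lin_ext_diff lin_ext_scale lin)
qed

lemma tlift_abs:
  assumes f: "cq_bilinear f"
  shows "tlift f (abs_tensor z) = lin_ext (\<lambda>(a, b). f a b) z"
proof -
  have "abs_tensor (rep_tensor (abs_tensor z)) = abs_tensor z"
    by (rule Quotient3_abs_rep[OF Quotient3_tensor])
  then have "rep_tensor (abs_tensor z) - z \<in> tensor_null"
    by (simp add: tensor.abs_eq_iff)
  from lin_ext_tensor_null[OF f this] show ?thesis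
    by (simp add: tlift_def lin_ext_diff)
qed

lemma tlift_tens: "cq_bilinear f \<Longrightarrow> tlift f (a \<otimes> b) = f a b"
  by (simp add: tens.abs_eq tlift_abs)

lemma cq_linear_tlift:
  assumes f: "cq_bilinear f"
  shows "cq_linear (tlift f)"
  unfolding cq_linear_def
proof (intro conjI allI)
  fix x y :: "('a, 'b) tensor" and c
  obtain p r where "x = abs_tensor p" "y = abs_tensor r"
    by (metis Quotient3_abs_rep[OF Quotient3_tensor])
  then show "tlift f (x + y) = tlift f x + tlift f y" "tlift f (c *\<^sub>q x) = c *\<^sub>q tlift f x"
    by (simp_all add: plus_tensor.abs_eq scaleq_tensor.abs_eq tlift_abs[OF f] lin_ext_add lin_ext_scale)
qed

lemma tensor_induct [case_names tens add]:
  assumes t: "\<And>a b. P (a \<otimes> b)" and add: "\<And>x y. P x \<Longrightarrow> P y \<Longrightarrow> P (x + y)"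
  shows "P x"
proof -
  obtain p where x: "x = abs_tensor p" by (metis Quotient3_abs_rep[OF Quotient3_tensor])
  have single: "P (abs_tensor (Poly_Mapping.single k c))" for k c
  proof (cases k)
    case (Pair a b)
    have "free_scale c (Poly_Mapping.single (a, b) 1) = Poly_Mapping.single (a, b) c"
      by (rule poly_mapping_eqI) (simp add: lookup_single when_def)
    then have "abs_tensor (Poly_Mapping.single (a, b) c) = c *\<^sub>q (a \<otimes> b)"
      by (simp add: tens.abs_eq scaleq_tensor.abs_eq)
    with Pair t show ?thesis by (simp add: tens_scale_left [symmetric])
  qed
  have "(0 :: 'a) \<otimes> (0 :: 'b) = 0" using tens_scale_left[of 0 "0 :: 'a" "0 :: 'b"] by simp
  with t[of 0 0] have zero: "P 0" by simp
  have "P (abs_tensor (\<Sum>k\<in>S. Poly_Mapping.single k (Poly_Mapping.lookup p k)))" if "finite S" for S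
    using that
  proof (induction S rule: finite_induct)
    case empty
    then show ?case using zero by (simp add: zero_tensor.abs_eq)
  next
    case (insert k S)
    then show ?case using add[OF single] by (simp add: plus_tensor.abs_eq [symmetric])
  qed
  moreover have "(\<Sum>k\<in>Poly_Mapping.keys p. Poly_Mapping.single k (Poly_Mapping.lookup p k)) = p"
    by (rule poly_mapping_eqI) (auto simp: lookup_sum lookup_single when_def in_keys_iff)
  ultimately have "P (abs_tensor p)" by (metis finite_keys)
  with x show ?thesis by simp
qed

lemma tlift_fun_add: "tlift (\<lambda>a b. f a b + g a b) z = tlift f z + tlift g z"
  by (simp add: tlift_def lin_ext_def case_prod_beta scaleq_right_distrib sum.distrib)

lemma tlift_fun_scale: "tlift (\<lambda>a b. c *\<^sub>q f a b) z = c *\<^sub>q tlift f z"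
  by (simp add: tlift_def lin_ext_def case_prod_beta cq.scale_sum_right mult.commute)

lemma cq_functional_exists:
  fixes v :: "'a::cq_vector"
  assumes "v \<noteq> 0"
  obtains \<phi> :: "'a \<Rightarrow> ratfun"
  where "\<And>x y. \<phi> (x + y) = \<phi> x + \<phi> y" "\<And>c x. \<phi> (c *\<^sub>q x) = c * \<phi> x" "\<phi> v = 1"
proof -
  interpret P: vector_space_pair "scaleq :: ratfun \<Rightarrow> 'a \<Rightarrow> 'a" "(*) :: ratfun \<Rightarrow> ratfun \<Rightarrow> ratfun"
    by standard (simp_all add: algebra_simps)
  have "cq.independent {v}" using assms by simp
  from P.linear_independent_extend[OF this, of "\<lambda>_. 1"]
  obtain g where g: "Vector_Spaces.linear scaleq (*) g" "g v = 1" by auto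
  then interpret L: Vector_Spaces.linear "scaleq :: ratfun \<Rightarrow> 'a \<Rightarrow> 'a" "(*)" g by simp
  show ?thesis using g(2) by (intro that[of g]) (simp_all add: L.add L.scale)
qed

instantiation tensor :: (cq_algebra, cq_algebra) cq_algebra
begin

definition one_tensor :: "('a, 'b) tensor" where
  "one_tensor = 1 \<otimes> 1"

definition times_tensor :: "('a, 'b) tensor \<Rightarrow> ('a, 'b) tensor \<Rightarrow> ('a, 'b) tensor" where
  "times_tensor x y = tlift (\<lambda>a b. tlift (\<lambda>c d. (a * c) \<otimes> (b * d)) y) x"

lemma tensor_mult_bilinear_inner: "cq_bilinear (\<lambda>c d. (a * c :: 'a) \<otimes> (b * d :: 'b))"
  by (simp add: cq_bilinear_def cq_linear_def distrib_left tens_add_left tens_add_right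
      mult_scaleq_right tens_scale_left tens_scale_right)

lemma tensor_mult_bilinear_outer:
  "cq_bilinear (\<lambda>a b. tlift (\<lambda>c d. (a * c :: 'a) \<otimes> (b * d :: 'b)) y)"
  by (simp add: cq_bilinear_def cq_linear_def distrib_right tens_add_left tens_add_right
      mult_scaleq_left tens_scale_left tens_scale_right tlift_fun_add tlift_fun_scale)

lemma tensor_mult_tens: "(a \<otimes> b) * (c \<otimes> d) = ((a * c :: 'a) \<otimes> (b * d :: 'b))"
  unfolding times_tensor_def tlift_tens[OF tensor_mult_bilinear_outer]
  by (rule tlift_tens[OF tensor_mult_bilinear_inner])

lemma tensor_mult_linear_left: "cq_linear (\<lambda>x :: ('a, 'b) tensor. x * y)"
  unfolding times_tensor_def by (rule cq_linear_tlift[OF tensor_mult_bilinear_outer])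

lemma tensor_mult_linear_right: "cq_linear (\<lambda>y :: ('a, 'b) tensor. x * y)"
  unfolding times_tensor_def cq_linear_def
  by (simp add: cq_linearD[OF cq_linear_tlift[OF tensor_mult_bilinear_inner]]
      tlift_fun_add tlift_fun_scale)

lemmas tensor_mult_linear =
  cq_linearD[OF tensor_mult_linear_left] cq_linearD[OF tensor_mult_linear_right]

instance
proof
  fix x y z :: "('a, 'b) tensor" and c :: ratfun
  show "(x + y) * z = x * z + y * z" "x * (y + z) = x * y + x * z"
    "(c *\<^sub>q x) * y = c *\<^sub>q (x * y)" "x * (c *\<^sub>q y) = c *\<^sub>q (x * y)"
    by (simp_all add: tensor_mult_linear)
  show "1 * x = x"
    by (induction x rule: tensor_induct) (simp_all add: one_tensor_def tensor_mult_tens tensor_mult_linear)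
  show "x * 1 = x"
    by (induction x rule: tensor_induct) (simp_all add: one_tensor_def tensor_mult_tens tensor_mult_linear)
  have 1: "(a \<otimes> b) * (c \<otimes> d) * z = (a \<otimes> b) * ((c \<otimes> d) * z)" for a c :: 'a and b d :: 'b
    by (induction z rule: tensor_induct) (simp_all add: tensor_mult_tens tensor_mult_linear mult.assoc)
  have 2: "(a \<otimes> b) * y * z = (a \<otimes> b) * (y * z)" for a :: 'a and b :: 'b
    by (induction y rule: tensor_induct) (simp_all add: 1 tensor_mult_linear)
  show "x * y * z = x * (y * z)"
    by (induction x rule: tensor_induct) (simp_all add: 2 tensor_mult_linear)
  obtain \<phi> :: "'a \<Rightarrow> ratfun" where \<phi>: "\<And>x y. \<phi> (x + y) = \<phi> x + \<phi> y"
    "\<And>c x. \<phi> (c *\<^sub>q x) = c * \<phi> x" "\<phi> 1 = 1"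
    by (rule cq_functional_exists[of "1 :: 'a"]) auto
  obtain \<psi> :: "'b \<Rightarrow> ratfun" where \<psi>: "\<And>x y. \<psi> (x + y) = \<psi> x + \<psi> y"
    "\<And>c x. \<psi> (c *\<^sub>q x) = c * \<psi> x" "\<psi> 1 = 1"
    by (rule cq_functional_exists[of "1 :: 'b"]) auto
  have b: "cq_bilinear (\<lambda>a b. (\<phi> a * \<psi> b) *\<^sub>q (1 :: 'a))"
    by (simp add: cq_bilinear_def cq_linear_def \<phi> \<psi> algebra_simps scaleq_left_distrib scaleq_scaleq)
  have "tlift (\<lambda>a b. (\<phi> a * \<psi> b) *\<^sub>q (1 :: 'a)) (1 :: ('a, 'b) tensor) = 1"
    by (simp add: one_tensor_def tlift_tens[OF b] \<phi> \<psi> scaleq_one)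
  then show "(0 :: ('a, 'b) tensor) \<noteq> 1"
    using cq_linearD(3)[OF cq_linear_tlift[OF b]] by auto
qed

end

definition tmap ::
    "('a::cq_vector \<Rightarrow> 'c::cq_vector) \<Rightarrow> ('b::cq_vector \<Rightarrow> 'd::cq_vector) \<Rightarrow>
     ('a, 'b) tensor \<Rightarrow> ('c, 'd) tensor" where
  "tmap f g = tlift (\<lambda>a b. f a \<otimes> g b)"

definition tassoc ::
    "(('a::cq_vector, 'b::cq_vector) tensor, 'c::cq_vector) tensor \<Rightarrow> ('a, ('b, 'c) tensor) tensor" where
  "tassoc = tlift (\<lambda>w c. tlift (\<lambda>a b. a \<otimes> (b \<otimes> c)) w)"

definition tswap_mid ::
    "(('a::cq_vector, 'b::cq_vector) tensor, ('c::cq_vector, 'd::cq_vector) tensor) tensor \<Rightarrow>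
     (('a, 'c) tensor, ('b, 'd) tensor) tensor" where
  "tswap_mid = tlift (\<lambda>v w. tlift (\<lambda>a b. tlift (\<lambda>c d. (a \<otimes> c) \<otimes> (b \<otimes> d)) w) v)"

datatype 'a op = Op (unop: 'a)

instantiation op :: (cq_vector) cq_vector
begin

definition "0 = Op 0"
definition "x + y = Op (unop x + unop y)"
definition "x - y = Op (unop x - unop y)"
definition "- x = Op (- unop x)"
definition "c *\<^sub>q x = Op (c *\<^sub>q unop x)"

instance
  by standard (simp_all add: zero_op_def plus_op_def minus_op_def uminus_op_def scaleq_op_def
      scaleq_right_distrib scaleq_left_distrib scaleq_scaleq scaleq_one add_ac)

end

instantiation op :: (cq_algebra) cq_algebra
begin

definition "1 = Op 1"
definition "x * y = Op (unop y * unop x)"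

instance
  by standard (simp_all add: zero_op_def plus_op_def scaleq_op_def one_op_def times_op_def
      distrib_left distrib_right mult_scaleq_left mult_scaleq_right mult.assoc)

end

locale hopf_algebra =
  fixes \<Delta> :: "'h::cq_algebra \<Rightarrow> ('h, 'h) tensor"
    and \<epsilon> :: "'h \<Rightarrow> ratfun"
    and \<sigma> :: "'h \<Rightarrow> 'h"
  assumes comult_hom: "cq_algebra_hom \<Delta>"
    and counit_add: "\<epsilon> (x + y) = \<epsilon> x + \<epsilon> y"
    and counit_scale: "\<epsilon> (c *\<^sub>q x) = c * \<epsilon> x"
    and counit_one: "\<epsilon> 1 = 1"
    and counit_mult: "\<epsilon> (x * y) = \<epsilon> x * \<epsilon> y"
    and coassoc: "tassoc (tmap \<Delta> id (\<Delta> x)) = tmap id \<Delta> (\<Delta> x)"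
    and counit_left: "tlift (\<lambda>a b. \<epsilon> a *\<^sub>q b) (\<Delta> x) = x"
    and counit_right: "tlift (\<lambda>a b. \<epsilon> b *\<^sub>q a) (\<Delta> x) = x"
    and antipode_linear: "cq_linear \<sigma>"
    and antipode_left: "tlift (\<lambda>a b. \<sigma> a * b) (\<Delta> x) = \<epsilon> x *\<^sub>q 1"
    and antipode_right: "tlift (\<lambda>a b. a * \<sigma> b) (\<Delta> x) = \<epsilon> x *\<^sub>q 1"

definition comult_op :: "('h::cq_algebra \<Rightarrow> ('h, 'h) tensor) \<Rightarrow> 'h op \<Rightarrow> ('h op, 'h op) tensor" where
  "comult_op \<Delta> u = tmap Op Op (\<Delta> (unop u))"

definition antipode_op :: "('h::cq_algebra \<Rightarrow> 'h) \<Rightarrow> 'h op \<Rightarrow> 'h op" where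
  "antipode_op \<sigma> u = Op (inv \<sigma> (unop u))"

definition comult_tensor ::
    "('h::cq_algebra \<Rightarrow> ('h, 'h) tensor) \<Rightarrow> ('k::cq_algebra \<Rightarrow> ('k, 'k) tensor) \<Rightarrow>
     ('h, 'k) tensor \<Rightarrow> (('h, 'k) tensor, ('h, 'k) tensor) tensor" where
  "comult_tensor \<Delta> \<Delta>' z = tswap_mid (tmap \<Delta> \<Delta>' z)"

definition adj ::
    "('h::cq_algebra \<Rightarrow> ('h, 'h) tensor) \<Rightarrow> ('h \<Rightarrow> 'h) \<Rightarrow> 'h \<Rightarrow> 'h \<Rightarrow> 'h" where
  "adj \<Delta> \<sigma> a b = tlift (\<lambda>a1 a2. a1 * b * \<sigma> a2) (\<Delta> a)"

definition locally_finite_part ::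
    "('h::cq_algebra \<Rightarrow> ('h, 'h) tensor) \<Rightarrow> ('h \<Rightarrow> 'h) \<Rightarrow> 'h set" where
  "locally_finite_part \<Delta> \<sigma> = {v. \<exists>B. finite B \<and> range (\<lambda>a. adj \<Delta> \<sigma> a v) \<subseteq> cq.span B}"

definition psi ::
    "('h::cq_algebra \<Rightarrow> ('h, 'h) tensor) \<Rightarrow> ('h \<Rightarrow> 'h) \<Rightarrow> 'h \<Rightarrow> ('h, 'h op) tensor" where
  "psi \<Delta> \<sigma> u = tlift (\<lambda>u1 u2. u1 \<otimes> Op (\<sigma> u2)) (\<Delta> u)"

text \<open>F_env is F(U \<otimes> U^op), and F_env_psi is the product of subspaces F(U \<otimes> U^op) psi(U),
  that is, the span of all products.\<close>

definition F_env ::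
    "('h::cq_algebra \<Rightarrow> ('h, 'h) tensor) \<Rightarrow> ('h \<Rightarrow> 'h) \<Rightarrow> ('h, 'h op) tensor set" where
  "F_env \<Delta> \<sigma> =
     locally_finite_part (comult_tensor \<Delta> (comult_op \<Delta>)) (tmap \<sigma> (antipode_op \<sigma>))"

definition F_env_psi ::
    "('h::cq_algebra \<Rightarrow> ('h, 'h) tensor) \<Rightarrow> ('h \<Rightarrow> 'h) \<Rightarrow> ('h, 'h op) tensor set" where
  "F_env_psi \<Delta> \<sigma> = cq.span {f * psi \<Delta> \<sigma> u | f u. f \<in> F_env \<Delta> \<sigma>}"

text \<open>Actions of a subset of an algebra are functions that are undefined off that subset,
  so that a module structure is determined by its values on the subalgebra alone.
  In a right module structure, r c m stands for m \<cdot> c.\<close>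

definition bilinear_action_on ::
    "'a::cq_algebra set \<Rightarrow> ('a \<Rightarrow> 'm::cq_vector \<Rightarrow> 'm) \<Rightarrow> bool" where
  "bilinear_action_on A act \<longleftrightarrow> act \<in> extensional A \<and>
     (\<forall>a\<in>A. cq_linear (act a)) \<and>
     (\<forall>a\<in>A. \<forall>b\<in>A. \<forall>m. act (a + b) m = act a m + act b m) \<and>
     (\<forall>c. \<forall>a\<in>A. \<forall>m. act (c *\<^sub>q a) m = c *\<^sub>q act a m)"

definition left_module_on ::
    "'a::cq_algebra set \<Rightarrow> ('a \<Rightarrow> 'm::cq_vector \<Rightarrow> 'm) \<Rightarrow> bool" where
  "left_module_on A act \<longleftrightarrow> bilinear_action_on A act \<and> (\<forall>m. act 1 m = m) \<and>
     (\<forall>a\<in>A. \<forall>b\<in>A. \<forall>m. act (a * b) m = act a (act b m))"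

definition right_module_on ::
    "'a::cq_algebra set \<Rightarrow> ('a \<Rightarrow> 'm::cq_vector \<Rightarrow> 'm) \<Rightarrow> bool" where
  "right_module_on A r \<longleftrightarrow> bilinear_action_on A r \<and> (\<forall>m. r 1 m = m) \<and>
     (\<forall>a\<in>A. \<forall>b\<in>A. \<forall>m. r (a * b) m = r b (r a m))"

definition bimodule_on ::
    "'a::cq_algebra set \<Rightarrow> ('a \<Rightarrow> 'm::cq_vector \<Rightarrow> 'm) \<Rightarrow> ('a \<Rightarrow> 'm \<Rightarrow> 'm) \<Rightarrow> bool" where
  "bimodule_on A l r \<longleftrightarrow> left_module_on A l \<and> right_module_on A r \<and>
     (\<forall>b\<in>A. \<forall>c\<in>A. \<forall>m. r c (l b m) = l b (r c m))"

text \<open>Since m \<cdot> a(2) is defined only for a(2) in F(U), the Sweedler sum in the second condition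
  is taken over an expression of \<Delta> a as an element of U \<otimes> F(U). Such an expression
  exists, and the sum does not depend on it.\<close>

definition compatible_ad_action ::
    "('u::cq_algebra \<Rightarrow> ('u, 'u) tensor) \<Rightarrow> ('u \<Rightarrow> 'u) \<Rightarrow>
     ('u \<Rightarrow> 'm::cq_vector \<Rightarrow> 'm) \<Rightarrow> ('u \<Rightarrow> 'm \<Rightarrow> 'm) \<Rightarrow> ('u \<Rightarrow> 'm \<Rightarrow> 'm) \<Rightarrow> bool" where
  "compatible_ad_action \<Delta> \<sigma> l r ad \<longleftrightarrow>
     left_module_on UNIV ad \<and>
     (\<forall>a m. \<forall>b\<in>locally_finite_part \<Delta> \<sigma>. \<forall>c\<in>locally_finite_part \<Delta> \<sigma>.
        ad a (r c (l b m)) =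
          tlift (\<lambda>a12 a3. tlift (\<lambda>a1 a2. r (adj \<Delta> \<sigma> a3 c) (l (adj \<Delta> \<sigma> a1 b) (ad a2 m))) a12)
            (tmap \<Delta> id (\<Delta> a))) \<and>
     (\<forall>a\<in>locally_finite_part \<Delta> \<sigma>. \<forall>m. \<forall>ps.
        set ps \<subseteq> UNIV \<times> locally_finite_part \<Delta> \<sigma> \<longrightarrow>
        \<Delta> a = (\<Sum>(a1, a2)\<leftarrow>ps. a1 \<otimes> a2) \<longrightarrow>
        (\<Sum>(a1, a2)\<leftarrow>ps. r a2 (ad a1 m)) = l a m)"

definition compatible_bimodules ::
    "('u::cq_algebra \<Rightarrow> ('u, 'u) tensor) \<Rightarrow> ('u \<Rightarrow> 'u) \<Rightarrow>
     (('u \<Rightarrow> 'm::cq_vector \<Rightarrow> 'm) \<times> ('u \<Rightarrow> 'm \<Rightarrow> 'm) \<times> ('u \<Rightarrow> 'm \<Rightarrow> 'm)) set" where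
  "compatible_bimodules \<Delta> \<sigma> =
     {(l, r, ad). bimodule_on (locally_finite_part \<Delta> \<sigma>) l r \<and> compatible_ad_action \<Delta> \<sigma> l r ad}"

text \<open>The identification keeps the vector space M: an F(U \<otimes> U^op) psi(U)-module is sent to
  b \<cdot> m = (b \<otimes> 1) m, m \<cdot> c = (1 \<otimes> c) m and (ad a) m = psi(a) m.\<close>

definition restrict_action ::
    "('u::cq_algebra \<Rightarrow> ('u, 'u) tensor) \<Rightarrow> ('u \<Rightarrow> 'u) \<Rightarrow>
     (('u, 'u op) tensor \<Rightarrow> 'm::cq_vector \<Rightarrow> 'm) \<Rightarrow>
     ('u \<Rightarrow> 'm \<Rightarrow> 'm) \<times> ('u \<Rightarrow> 'm \<Rightarrow> 'm) \<times> ('u \<Rightarrow> 'm \<Rightarrow> 'm)" where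
  "restrict_action \<Delta> \<sigma> act =
     (restrict (\<lambda>b. act (b \<otimes> 1)) (locally_finite_part \<Delta> \<sigma>),
      restrict (\<lambda>c. act (1 \<otimes> Op c)) (locally_finite_part \<Delta> \<sigma>),
      \<lambda>a. act (psi \<Delta> \<sigma> a))"

locale lie_algebra = vector_space scale
  for scale :: "complex \<Rightarrow> 'g::ab_group_add \<Rightarrow> 'g" +
  fixes br :: "'g \<Rightarrow> 'g \<Rightarrow> 'g"
  assumes br_add_left: "br (x + y) z = br x z + br y z"
    and br_add_right: "br x (y + z) = br x y + br x z"
    and br_scale_left: "br (scale c x) y = scale c (br x y)"
    and br_scale_right: "br x (scale c y) = scale c (br x y)"
    and br_self: "br x x = 0"
    and jacobi: "br x (br y z) + br y (br z x) + br z (br x y) = 0"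
begin

definition br_span :: "'g set \<Rightarrow> 'g set \<Rightarrow> 'g set" where
  "br_span A B = span {br a b | a b. a \<in> A \<and> b \<in> B}"

definition lie_ideal :: "'g set \<Rightarrow> bool" where
  "lie_ideal I \<longleftrightarrow> subspace I \<and> (\<forall>x. \<forall>y\<in>I. br x y \<in> I)"

definition solvable :: "'g set \<Rightarrow> bool" where
  "solvable A \<longleftrightarrow> (\<exists>k. ((\<lambda>D. br_span D D) ^^ k) A = {0})"

definition nilpotent :: "'g set \<Rightarrow> bool" where
  "nilpotent A \<longleftrightarrow> (\<exists>k. (br_span A ^^ k) A = {0})"

definition semisimple :: bool where
  "semisimple \<longleftrightarrow> (\<exists>B. finite B \<and> span B = UNIV) \<and> (\<forall>I. lie_ideal I \<and> solvable I \<longrightarrow> I = {0})"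

definition cartan_subalgebra :: "'g set \<Rightarrow> bool" where
  "cartan_subalgebra h \<longleftrightarrow> subspace h \<and> (\<forall>x\<in>h. \<forall>y\<in>h. br x y \<in> h) \<and> nilpotent h \<and>
     {x. \<forall>y\<in>h. br x y \<in> h} = h"

definition root_space :: "'g set \<Rightarrow> ('g \<Rightarrow> complex) \<Rightarrow> 'g set" where
  "root_space h \<beta> = {x. \<forall>H\<in>h. br H x = scale (\<beta> H) x}"

definition roots :: "'g set \<Rightarrow> ('g \<Rightarrow> complex) set" where
  "roots h = {\<beta> \<in> extensional h. (\<exists>H\<in>h. \<beta> H \<noteq> 0) \<and> root_space h \<beta> \<noteq> {0}}"

definition simple_roots :: "'g set \<Rightarrow> ('i::finite \<Rightarrow> 'g \<Rightarrow> complex) \<Rightarrow> bool" where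
  "simple_roots h \<alpha> \<longleftrightarrow> range \<alpha> \<subseteq> roots h \<and>
     (\<forall>c. (\<forall>H\<in>h. (\<Sum>i\<in>UNIV. c i * \<alpha> i H) = 0) \<longrightarrow> (\<forall>i. c i = 0)) \<and>
     (\<forall>\<beta>\<in>roots h. \<exists>k :: 'i \<Rightarrow> nat.
        (\<forall>H\<in>h. \<beta> H = (\<Sum>i\<in>UNIV. of_nat (k i) * \<alpha> i H)) \<or>
        (\<forall>H\<in>h. \<beta> H = - (\<Sum>i\<in>UNIV. of_nat (k i) * \<alpha> i H)))"

definition is_coroot :: "'g set \<Rightarrow> ('g \<Rightarrow> complex) \<Rightarrow> 'g \<Rightarrow> bool" where
  "is_coroot h \<beta> H \<longleftrightarrow> H \<in> h \<and>
     H \<in> br_span (root_space h \<beta>) (root_space h (\<lambda>H. - \<beta> H)) \<and> \<beta> H = 2"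

text \<open>ip i j is the value of the Cartan inner product on the i-th and j-th simple roots.
  The form is determined by the Cartan integers up to a positive factor on each simple component;
  any factors for which the exponents of the q_i are integers are admitted.\<close>

definition cartan_inner_product ::
    "'g set \<Rightarrow> ('i::finite \<Rightarrow> 'g \<Rightarrow> complex) \<Rightarrow> ('i \<Rightarrow> 'i \<Rightarrow> int) \<Rightarrow> bool" where
  "cartan_inner_product h \<alpha> ip \<longleftrightarrow>
     (\<forall>i j. ip i j = ip j i) \<and> (\<forall>i. 0 < ip i i \<and> even (ip i i)) \<and>
     (\<forall>i j H. is_coroot h (\<alpha> i) H \<longrightarrow> of_int (2 * ip i j) = of_int (ip i i) * \<alpha> j H)"

end

datatype 'x free_monoid = Word (letters: "'x list")

instantiation free_monoid :: (type) monoid_add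
begin

definition "0 = Word []"
definition "u + v = Word (letters u @ letters v)"

instance
  by standard (simp_all add: zero_free_monoid_def plus_free_monoid_def)

end

text \<open>With words under concatenation as an additive monoid, the convolution product
  of Poly_Mapping makes this the free associative algebra on 'x.\<close>

type_synonym 'x free_algebra = "'x free_monoid \<Rightarrow>\<^sub>0 ratfun"

definition free_gen :: "'x \<Rightarrow> 'x free_algebra" where
  "free_gen g = Poly_Mapping.single (Word [g]) 1"

definition free_const :: "ratfun \<Rightarrow> 'x free_algebra" where
  "free_const c = Poly_Mapping.single 0 c"

definition free_eval :: "('x \<Rightarrow> 'a::cq_algebra) \<Rightarrow> 'x free_algebra \<Rightarrow> 'a" where
  "free_eval g = lin_ext (\<lambda>w. prod_list (map g (letters w)))"

definition ideal_generated :: "'a::ring_1 set \<Rightarrow> 'a set" where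
  "ideal_generated R = \<Inter>{J. R \<subseteq> J \<and> 0 \<in> J \<and> (\<forall>u\<in>J. \<forall>v\<in>J. u + v \<in> J) \<and>
     (\<forall>a b. \<forall>u\<in>J. a * u * b \<in> J)}"

definition presented_by :: "('x \<Rightarrow> 'a::cq_algebra) \<Rightarrow> 'x free_algebra set \<Rightarrow> bool" where
  "presented_by g R \<longleftrightarrow> surj (free_eval g) \<and> {z. free_eval g z = 0} = ideal_generated R"

definition qnum :: "ratfun \<Rightarrow> nat \<Rightarrow> ratfun" where
  "qnum v m = (v powi int m - v powi (- int m)) / (v - inverse v)"

definition qfact :: "ratfun \<Rightarrow> nat \<Rightarrow> ratfun" where
  "qfact v m = (\<Prod>k=1..m. qnum v k)"

definition qbinom :: "ratfun \<Rightarrow> nat \<Rightarrow> nat \<Rightarrow> ratfun" where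
  "qbinom v n m = qfact v n / (qfact v m * qfact v (n - m))"

datatype 'i uq_gen = GX 'i | GY 'i | GT 'i | GTinv 'i

definition cartan_entry :: "('i \<Rightarrow> 'i \<Rightarrow> int) \<Rightarrow> 'i \<Rightarrow> 'i \<Rightarrow> int" where
  "cartan_entry ip i j = 2 * ip i j div ip i i"

definition q_i :: "('i \<Rightarrow> 'i \<Rightarrow> int) \<Rightarrow> 'i \<Rightarrow> ratfun" where
  "q_i ip i = qvar powi (ip i i div 2)"

definition serre_element ::
    "('i \<Rightarrow> 'i \<Rightarrow> int) \<Rightarrow> ('i \<Rightarrow> 'x free_algebra) \<Rightarrow> 'i \<Rightarrow> 'i \<Rightarrow> 'x free_algebra" where
  "serre_element ip z i j =
     (let N = nat (1 - cartan_entry ip i j)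
      in \<Sum>m\<le>N. free_const ((-1) ^ m * qbinom (q_i ip i) N m) * z i ^ (N - m) * z j * z i ^ m)"

definition uq_relators :: "('i \<Rightarrow> 'i \<Rightarrow> int) \<Rightarrow> 'i uq_gen free_algebra set" where
  "uq_relators ip =
     (let X = (\<lambda>i. free_gen (GX i)); Y = (\<lambda>i. free_gen (GY i));
          T = (\<lambda>i. free_gen (GT i)); T' = (\<lambda>i. free_gen (GTinv i));
          C = free_const
      in {X i * Y j - Y j * X i -
            (if i = j then C (1 / (q_i ip i - inverse (q_i ip i))) * (T i - T' i) else 0) | i j. True} \<union>
         {T i * T' i - 1 | i. True} \<union> {T' i * T i - 1 | i. True} \<union>
         {T i * T j - T j * T i | i j. True} \<union>
         {T i * X j - C (qvar powi ip i j) * X j * T i | i j. True} \<union>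
         {T i * Y j - C (qvar powi (- ip i j)) * Y j * T i | i j. True} \<union>
         {serre_element ip X i j | i j. i \<noteq> j} \<union>
         {serre_element ip Y i j | i j. i \<noteq> j})"

fun uq_assign ::
    "('i \<Rightarrow> 'u) \<Rightarrow> ('i \<Rightarrow> 'u) \<Rightarrow> ('i \<Rightarrow> 'u) \<Rightarrow> ('i \<Rightarrow> 'u) \<Rightarrow> 'i uq_gen \<Rightarrow> 'u" where
  "uq_assign x y t t' (GX i) = x i"
| "uq_assign x y t t' (GY i) = y i"
| "uq_assign x y t t' (GT i) = t i"
| "uq_assign x y t t' (GTinv i) = t' i"

text \<open>The type 'u with its generators is the algebra U_q(g), with t' i the inverse of t i;
  the comultiplication, counit and antipode are determined by their values on the generators.\<close>

locale quantized_enveloping_algebra =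
  lie_algebra scale br + hopf_algebra \<Delta> \<epsilon> \<sigma>
  for scale :: "complex \<Rightarrow> 'g::ab_group_add \<Rightarrow> 'g"
    and br :: "'g \<Rightarrow> 'g \<Rightarrow> 'g"
    and \<Delta> :: "'u::cq_algebra \<Rightarrow> ('u, 'u) tensor"
    and \<epsilon> :: "'u \<Rightarrow> ratfun"
    and \<sigma> :: "'u \<Rightarrow> 'u" +
  fixes h :: "'g set"
    and \<alpha> :: "'i::finite \<Rightarrow> 'g \<Rightarrow> complex"
    and ip :: "'i \<Rightarrow> 'i \<Rightarrow> int"
    and x y t t' :: "'i \<Rightarrow> 'u"
  assumes semisimple: "semisimple"
    and cartan_subalgebra: "cartan_subalgebra h"
    and simple_roots: "simple_roots h \<alpha>"
    and cartan_inner_product: "cartan_inner_product h \<alpha> ip"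
    and presentation: "presented_by (uq_assign x y t t') (uq_relators ip)"
    and comult_t: "\<Delta> (t i) = t i \<otimes> t i" "\<Delta> (t' i) = t' i \<otimes> t' i"
    and comult_x: "\<Delta> (x i) = x i \<otimes> 1 + t i \<otimes> x i"
    and comult_y: "\<Delta> (y i) = y i \<otimes> t' i + 1 \<otimes> y i"
    and counit_gen: "\<epsilon> (t i) = 1" "\<epsilon> (t' i) = 1" "\<epsilon> (x i) = 0" "\<epsilon> (y i) = 0"
    and antipode_t: "\<sigma> (t i) = t' i" "\<sigma> (t' i) = t i"
    and antipode_x: "\<sigma> (x i) = - (t' i * x i)"
    and antipode_y: "\<sigma> (y i) = - (y i * t i)"

end

theory Submission
  imports Defs
begin

text \<open>The point is that the product of subspaces F(U \<otimes> U^op) psi(U) equals (1 \<otimes> F(U)^op) psi(U), because a \<otimes> 1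
  is the sum of the (1 \<otimes> a(2)) psi(a(1)) and \<Delta>(F(U)) lies in U \<otimes> F(U). The map sending u \<otimes> c to
  (1 \<otimes> c) psi(u) has the inverse sending u \<otimes> c to the sum of the u(1) \<otimes> u(2) c, so that m \<cdot> c and (ad u) m
  together determine an action of the whole subalgebra. The second compatibility condition says that
  this action restricts to the given left multiplication. The first one is its multiplicativity, since
  psi(u) (b \<otimes> c) is the sum of the ((ad u(1)) b \<otimes> (ad u(3)) c) psi(u(2)).\<close>

section \<open>Linear maps and tensors\<close>

text \<open>Prescribing an action on the products (b \<otimes> c) psi(u) would require checking that
  it respects every linear relation among them. Instead the inverse map is defined linearly on all
  of U \<otimes> U^op and the action is obtained by composing with it, so that no well-definedness
  is left to check. Three standard facts carry the argument and are proved here: \<Delta>(F(U)) lies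
  in U \<otimes> F(U); F(U \<otimes> U^op) = F(U) \<otimes> F(U)^op; the antipode of U is bijective.
  For the first two, local finiteness has to pass from a tensor to its single factors, which is done
  by contracting a shortest tensor sum with dual functionals. Bijectivity matters because the
  antipode of U^op is \<sigma>^-1. It is the point where the presentation of U by generators and
  relations enters; the rest is an argument about Hopf algebras with bijective antipode. Actions of
  F(U) are undefined outside F(U), so each Sweedler sum has to be brought into F(U) before they can
  be applied to it.\<close>

named_theorems lin_intros

lemma cq_linearI:
  assumes "\<And>x y. f (x + y) = f x + f y" and "\<And>c x. f (c *\<^sub>q x) = c *\<^sub>q f x"
  shows "cq_linear f"
  using assms by (simp add: cq_linear_def)

text \<open>Most rules in \<open>lin_intros\<close> carry an inner linear map (\<open>f x\<close>
  rather than \<open>x\<close>), so that backward resolution descends through a term and settles the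
  slotwise linearity conditions of the Sweedler identities below.\<close>

lemma cq_bilinearI [lin_intros]:
  assumes "\<And>b. cq_linear (\<lambda>a. f a b)" and "\<And>a. cq_linear (\<lambda>b. f a b)"
  shows "cq_bilinear f"
  using assms by (simp add: cq_bilinear_def)

lemma cq_bilinearD:
  assumes "cq_bilinear f"
  shows "cq_linear (\<lambda>a. f a b)" "cq_linear (\<lambda>b. f a b)"
  using assms by (simp_all add: cq_bilinear_def)

lemma cq_linear_id [lin_intros]: "cq_linear (\<lambda>x. x)"
  by (simp add: cq_linear_def)

lemma cq_linear_compose:
  assumes "cq_linear f" "cq_linear g"
  shows "cq_linear (\<lambda>x. f (g x))"
  using assms by (simp add: cq_linear_def)

lemma cq_linear_diff: "cq_linear f \<Longrightarrow> cq_linear g \<Longrightarrow> cq_linear (\<lambda>x. f x - g x)"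
  by (simp add: cq_linear_def cq.scale_right_diff_distrib)

lemma cq_linear_scale [lin_intros]: "cq_linear f \<Longrightarrow> cq_linear (\<lambda>x. c *\<^sub>q f x)"
  by (simp add: cq_linear_def scaleq_right_distrib scaleq_scaleq mult.commute)

lemma cq_linear_sum:
  assumes "cq_linear g"
  shows "g (\<Sum>i\<in>I. f i) = (\<Sum>i\<in>I. g (f i))"
  by (induction I rule: infinite_finite_induct) (simp_all add: cq_linearD[OF assms])

lemma cq_linear_mult_left [lin_intros]:
  fixes f :: "'a::cq_vector \<Rightarrow> 'b::cq_algebra"
  shows "cq_linear f \<Longrightarrow> cq_linear (\<lambda>x. f x * c)"
  by (simp add: cq_linear_def distrib_right mult_scaleq_left)

lemma cq_linear_mult_right [lin_intros]:
  fixes f :: "'a::cq_vector \<Rightarrow> 'b::cq_algebra"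
  shows "cq_linear f \<Longrightarrow> cq_linear (\<lambda>x. c * f x)"
  by (simp add: cq_linear_def distrib_left mult_scaleq_right)

lemma cq_linear_tens_left [lin_intros]: "cq_linear f \<Longrightarrow> cq_linear (\<lambda>x. f x \<otimes> c)"
  by (simp add: cq_linear_def tens_add_left tens_scale_left)

lemma cq_linear_tens_right [lin_intros]: "cq_linear f \<Longrightarrow> cq_linear (\<lambda>x. c \<otimes> f x)"
  by (simp add: cq_linear_def tens_add_right tens_scale_right)

lemma cq_linear_Op [lin_intros]: "cq_linear f \<Longrightarrow> cq_linear (\<lambda>x. Op (f x))"
  by (simp add: cq_linear_def plus_op_def scaleq_op_def)

lemma cq_linear_unop [lin_intros]: "cq_linear f \<Longrightarrow> cq_linear (\<lambda>x. unop (f x))"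
  by (simp add: cq_linear_def plus_op_def scaleq_op_def)

lemma cq_linear_tlift_arg [lin_intros]:
  "cq_bilinear f \<Longrightarrow> cq_linear g \<Longrightarrow> cq_linear (\<lambda>x. tlift f (g x))"
  by (rule cq_linear_compose[OF cq_linear_tlift])

lemma cq_linear_tlift_fun [lin_intros]:
  assumes "\<And>a b. cq_linear (\<lambda>x. f x a b)"
  shows "cq_linear (\<lambda>x. tlift (f x) z)"
proof (rule cq_linearI)
  fix x y
  have "f (x + y) = (\<lambda>a b. f x a b + f y a b)" using assms by (simp add: cq_linear_def fun_eq_iff)
  then show "tlift (f (x + y)) z = tlift (f x) z + tlift (f y) z"
    by (simp add: tlift_fun_add)
next
  fix c x
  have "f (c *\<^sub>q x) = (\<lambda>a b. c *\<^sub>q f x a b)" using assms by (simp add: cq_linear_def fun_eq_iff)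
  then show "tlift (f (c *\<^sub>q x)) z = c *\<^sub>q tlift (f x) z"
    by (simp add: tlift_fun_scale)
qed

lemma cq_linear_tmap [lin_intros]:
  assumes "cq_linear f" "cq_linear g" "cq_linear k"
  shows "cq_linear (\<lambda>x. tmap f g (k x))"
  unfolding tmap_def
  by (intro lin_intros assms cq_linear_compose[OF assms(1)] cq_linear_compose[OF assms(2)])

lemma tmap_tens:
  assumes "cq_linear f" "cq_linear g"
  shows "tmap f g (a \<otimes> b) = f a \<otimes> g b"
  unfolding tmap_def
  by (rule tlift_tens)
    (intro lin_intros cq_linear_compose[OF assms(1)] cq_linear_compose[OF assms(2)])

text \<open>\<open>tlift f z\<close> is by definition a finite linear combination of values of
  \<open>f\<close> over one fixed representative of \<open>z\<close>, and linear maps pass through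
  such a sum for every \<open>f\<close>.\<close>

lemma linear_tlift:
  assumes "cq_linear g"
  shows "g (tlift f z) = tlift (\<lambda>a b. g (f a b)) z"
  by (simp add: tlift_def lin_ext_def cq_linear_sum[OF assms] case_prod_beta cq_linearD[OF assms])

lemma tlift_mult_left: "tlift f z * (c :: 'a::cq_algebra) = tlift (\<lambda>a b. f a b * c) z"
  by (rule linear_tlift) (intro lin_intros)

lemma tlift_mult_right: "(c :: 'a::cq_algebra) * tlift f z = tlift (\<lambda>a b. c * f a b) z"
  by (rule linear_tlift) (intro lin_intros)

lemma tlift_tens_left: "tlift f z \<otimes> c = tlift (\<lambda>a b. f a b \<otimes> c) z"
  by (rule linear_tlift) (intro lin_intros)

lemma tlift_tens_right: "c \<otimes> tlift f z = tlift (\<lambda>a b. c \<otimes> f a b) z"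
  by (rule linear_tlift) (intro lin_intros)

lemma tlift_Op: "Op (tlift f z) = tlift (\<lambda>a b. Op (f a b)) z"
  by (rule linear_tlift) (intro lin_intros)

text \<open>Both sides are the same double sum over fixed representatives; in use, Sweedler sums of
  two independent elements commute.\<close>

lemma tlift_swap:
  "tlift (\<lambda>a b. tlift (\<lambda>c d. f a b c d) w) z = tlift (\<lambda>c d. tlift (\<lambda>a b. f a b c d) z) w"
  by (simp add: tlift_def lin_ext_def case_prod_beta cq.scale_sum_right scaleq_scaleq mult.commute)
    (rule sum.swap)

lemma tlift_tmap:
  assumes "cq_bilinear F" "cq_linear f" "cq_linear g"
  shows "tlift F (tmap f g z) = tlift (\<lambda>a b. F (f a) (g b)) z"
  unfolding tmap_def using assms
  by (simp add: linear_tlift[OF cq_linear_tlift[OF assms(1)]] tlift_tens)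

lemma tensor_eqI:
  assumes "cq_linear f" "cq_linear g" "\<And>a b. f (a \<otimes> b) = g (a \<otimes> b)"
  shows "f z = g z"
  by (induction z rule: tensor_induct) (simp_all add: assms cq_linearD[OF assms(1)] cq_linearD[OF assms(2)])

lemma tlift_tens_id: "tlift (\<otimes>) z = z"
proof (rule tensor_eqI[of "tlift (\<otimes>)" "\<lambda>z. z"])
  show "cq_linear (tlift (\<otimes>))" by (rule cq_linear_tlift[OF cq_bilinear_tens])
  show "tlift (\<otimes>) (a \<otimes> b) = a \<otimes> b" for a :: 'a and b :: 'b
    by (rule tlift_tens[OF cq_bilinear_tens])
qed (rule cq_linear_id)

lemma tlift_in_subspace:
  assumes "cq.subspace W" "\<And>a b. f a b \<in> W"
  shows "tlift f z \<in> W"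
  unfolding tlift_def lin_ext_def case_prod_beta
  by (intro cq.subspace_sum cq.subspace_scale assms)

lemma cq_linear_span_image:
  assumes "cq_linear f" "x \<in> cq.span B" "\<And>b. b \<in> B \<Longrightarrow> f b \<in> W" "cq.subspace W"
  shows "f x \<in> W"
  using assms(2)
proof (induction rule: cq.span_induct_alt)
  case base
  show ?case using assms by (simp add: cq_linearD cq.subspace_0)
next
  case (step c x y)
  then show ?case using assms by (simp add: cq_linearD cq.subspace_add cq.subspace_scale)
qed

section \<open>Dual functionals and shortest tensor sums\<close>

lemma dual_functional_exists:
  fixes w :: "'a::cq_vector"
  assumes "w \<notin> cq.span S"
  obtains \<phi> :: "'a \<Rightarrow> ratfun"
  where "\<And>x y. \<phi> (x + y) = \<phi> x + \<phi> y" "\<And>c x. \<phi> (c *\<^sub>q x) = c * \<phi> x" "\<phi> w = 1"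
    "\<And>x. x \<in> S \<Longrightarrow> \<phi> x = 0"
proof -
  interpret P: vector_space_pair "scaleq :: ratfun \<Rightarrow> 'a \<Rightarrow> 'a" "(*) :: ratfun \<Rightarrow> ratfun \<Rightarrow> ratfun"
    by standard (simp_all add: algebra_simps)
  obtain B where B: "B \<subseteq> S" "cq.independent B" "S \<subseteq> cq.span B"
    by (rule cq.maximal_independent_subset)
  have "w \<notin> cq.span B" using assms B(1) cq.span_mono by blast
  then have "cq.independent (insert w B)" using B(2) by (simp add: cq.independent_insert)
  \<comment> \<open>Since \<open>insert w B\<close> is independent, the values 1 at \<open>w\<close>
    and 0 on \<open>B\<close> may be prescribed freely; vanishing on \<open>S\<close> follows
    because \<open>B\<close> spans it.\<close>
  from P.linear_independent_extend[OF this, of "\<lambda>x. if x = w then 1 else 0"]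
  obtain g where g: "Vector_Spaces.linear scaleq (*) g"
    "\<And>x. x \<in> insert w B \<Longrightarrow> g x = (if x = w then 1 else 0)" by metis
  then interpret L: Vector_Spaces.linear "scaleq :: ratfun \<Rightarrow> 'a \<Rightarrow> 'a" "(*)" g by simp
  have gB: "g b = 0" if "b \<in> B" for b
    using that g(2)[of b] \<open>w \<notin> cq.span B\<close> by (metis cq.span_base insertI2)
  have "g x = 0" if "x \<in> S" for x
  proof -
    have "x \<in> cq.span B" using that B(3) by blast
    then show ?thesis
      by (induction rule: cq.span_induct_alt) (simp_all add: L.add L.scale gB L.zero)
  qed
  then show ?thesis using g(2)[of w] by (intro that[of g]) (simp_all add: L.add L.scale)
qed

lemma tensor_sum_exists:
  obtains n and a :: "nat \<Rightarrow> 'a::cq_vector" and b :: "nat \<Rightarrow> 'b::cq_vector"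
  where "z = (\<Sum>i<n. a i \<otimes> b i)"
proof -
  have "\<exists>n a b. z = (\<Sum>i<(n::nat). a i \<otimes> b i)"
  proof (induction z rule: tensor_induct)
    case (tens a b)
    show ?case
      by (rule exI[of _ 1], rule exI[of _ "\<lambda>_. a"], rule exI[of _ "\<lambda>_. b"]) simp
  next
    case (add x y)
    then obtain n a b m c d where xy: "x = (\<Sum>i<(n::nat). a i \<otimes> b i)" "y = (\<Sum>i<(m::nat). c i \<otimes> d i)"
      by blast
    let ?a = "\<lambda>i. if i < n then a i else c (i - n)" and ?b = "\<lambda>i. if i < n then b i else d (i - n)"
    have "(\<Sum>i<n + m. ?a i \<otimes> ?b i) = (\<Sum>i=0..<n. ?a i \<otimes> ?b i) + (\<Sum>i=n..<n + m. ?a i \<otimes> ?b i)"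
      unfolding lessThan_atLeast0 by (rule sum.atLeastLessThan_concat[symmetric]) simp_all
    also have "(\<Sum>i=n..<n + m. ?a i \<otimes> ?b i) = y"
      using sum.shift_bounds_nat_ivl[of "\<lambda>i. ?a i \<otimes> ?b i" 0 n m]
      by (simp add: xy add.commute lessThan_atLeast0)
    also have "(\<Sum>i=0..<n. ?a i \<otimes> ?b i) = x"
      by (simp add: xy lessThan_atLeast0)
    finally have "x + y = (\<Sum>i<n + m. ?a i \<otimes> ?b i)" by (rule sym)
    then show ?case by (intro exI)
  qed
  then show ?thesis using that by blast
qed

lemma span_image_sum:
  assumes "finite I" "x \<in> cq.span (a ` I)"
  obtains c where "x = (\<Sum>i\<in>I. c i *\<^sub>q a i)"
proof -
  from assms(2) have "\<exists>c. x = (\<Sum>i\<in>I. c i *\<^sub>q a i)"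
  proof (induction rule: cq.span_induct_alt)
    case base
    show ?case by (rule exI[of _ "\<lambda>_. 0"]) simp
  next
    case (step r x y)
    then obtain j c where j: "j \<in> I" "x = a j" and c: "y = (\<Sum>i\<in>I. c i *\<^sub>q a i)" by blast
    have "(\<Sum>i\<in>I. (if i = j then r else 0) *\<^sub>q a i) = (\<Sum>i\<in>I. if i = j then r *\<^sub>q a i else 0)"
      by (rule sum.cong) auto
    also have "\<dots> = r *\<^sub>q x"
      using j assms(1) by simp
    finally have "r *\<^sub>q x + y = (\<Sum>i\<in>I. ((if i = j then r else 0) + c i) *\<^sub>q a i)"
      unfolding scaleq_left_distrib sum.distrib c by simp
    then show ?case by (rule exI[of _ "\<lambda>i. (if i = j then r else 0) + c i"])
  qed
  then show ?thesis using that by blast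
qed

text \<open>The dependent factor is expanded and its coefficients are moved to the other argument,
  which shortens the sum by one term. A general bilinear map is used so that the lemma serves either
  side of a tensor.\<close>

lemma bilinear_sum_eliminate:
  fixes a :: "'i \<Rightarrow> 'a::cq_vector" and b :: "'i \<Rightarrow> 'b::cq_vector" and f :: "'a \<Rightarrow> 'b \<Rightarrow> 'c::cq_vector"
  assumes f: "cq_bilinear f" and I: "finite I" "j \<in> I" and "a j \<in> cq.span (a ` (I - {j}))"
  shows "\<exists>b'. (\<Sum>i\<in>I. f (a i) (b i)) = (\<Sum>i\<in>I - {j}. f (a i) (b' i))"
proof -
  note lin = cq_linearD[OF cq_bilinearD(1)[OF f]] cq_linearD[OF cq_bilinearD(2)[OF f]]
  obtain c where c: "a j = (\<Sum>i\<in>I - {j}. c i *\<^sub>q a i)"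
    using span_image_sum[of "I - {j}" "a j" a] assms by auto
  have "(\<Sum>i\<in>I. f (a i) (b i)) = f (a j) (b j) + (\<Sum>i\<in>I - {j}. f (a i) (b i))"
    using I by (simp add: sum.remove)
  also have "f (a j) (b j) = (\<Sum>i\<in>I - {j}. f (a i) (c i *\<^sub>q b j))"
    unfolding c by (simp add: cq_linear_sum[OF cq_bilinearD(1)[OF f]] lin)
  finally have "(\<Sum>i\<in>I. f (a i) (b i)) = (\<Sum>i\<in>I - {j}. f (a i) (c i *\<^sub>q b j + b i))"
    by (simp add: sum.distrib lin)
  then show ?thesis by (rule exI[of _ "\<lambda>i. c i *\<^sub>q b j + b i"])
qed

text \<open>A sum with the least number of terms works, since a dependent factor on either side
  could be eliminated. Independence is stated index by index, which also excludes repeated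
  factors.\<close>

lemma minimal_tensor_sum:
  obtains I :: "nat set" and a :: "nat \<Rightarrow> 'a::cq_vector" and b :: "nat \<Rightarrow> 'b::cq_vector"
  where "finite I" "z = (\<Sum>i\<in>I. a i \<otimes> b i)"
    "\<And>j. j \<in> I \<Longrightarrow> a j \<notin> cq.span (a ` (I - {j}))"
    "\<And>j. j \<in> I \<Longrightarrow> b j \<notin> cq.span (b ` (I - {j}))"
proof -
  define P where "P N \<longleftrightarrow> (\<exists>(I :: nat set) (a :: nat \<Rightarrow> 'a) (b :: nat \<Rightarrow> 'b).
    finite I \<and> card I = N \<and> z = (\<Sum>i\<in>I. a i \<otimes> b i))" for N
  obtain n and a :: "nat \<Rightarrow> 'a" and b :: "nat \<Rightarrow> 'b" where "z = (\<Sum>i<n. a i \<otimes> b i)"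
    by (rule tensor_sum_exists)
  then have "P n" unfolding P_def by (intro exI[of _ "{..<n}"] exI[of _ a] exI[of _ b]) simp
  then obtain N where "P N" and N: "\<And>M. P M \<Longrightarrow> N \<le> M"
    using ex_has_least_nat[of P n "\<lambda>x. x"] by blast
  from this(1)[unfolded P_def] obtain I :: "nat set" and a b where fin: "finite I" and card: "card I = N"
    and z: "z = (\<Sum>i\<in>I. a i \<otimes> b i)" by blast
  have less: "z \<noteq> (\<Sum>i\<in>I - {j}. a' i \<otimes> b' i)" if "j \<in> I" for j a' b'
  proof
    assume "z = (\<Sum>i\<in>I - {j}. a' i \<otimes> b' i)"
    then have "P (card (I - {j}))"
      unfolding P_def using fin by (intro exI[of _ "I - {j}"] exI[of _ a'] exI[of _ b']) simp
    then have "card I \<le> card (I - {j})" unfolding card by (rule N)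
    with card_Diff1_less[OF fin that] show False by linarith
  qed
  \<comment> \<open>The tensor product with its arguments exchanged makes the elimination apply to
    the right factors.\<close>
  have swap: "cq_bilinear (\<lambda>b (a :: 'a). a \<otimes> (b :: 'b))" by (intro lin_intros)
  show ?thesis
  proof (rule that[OF fin z])
    fix j assume j: "j \<in> I"
    show "a j \<notin> cq.span (a ` (I - {j}))"
      using bilinear_sum_eliminate[OF cq_bilinear_tens fin j, of a b] less[OF j] unfolding z by blast
    show "b j \<notin> cq.span (b ` (I - {j}))"
      using bilinear_sum_eliminate[OF swap fin j, of b a] less[OF j] unfolding z by blast
  qed
qed

section \<open>Sweedler calculus\<close>

context hopf_algebra
begin

abbreviation sw :: "('h \<Rightarrow> 'h \<Rightarrow> 'a::cq_vector) \<Rightarrow> 'h \<Rightarrow> 'a" where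
  "sw f u \<equiv> tlift f (\<Delta> u)"

abbreviation AD :: "'h \<Rightarrow> 'h \<Rightarrow> 'h" where
  "AD \<equiv> adj \<Delta> \<sigma>"

abbreviation LF :: "'h set" where
  "LF \<equiv> locally_finite_part \<Delta> \<sigma>"

abbreviation \<psi> :: "'h \<Rightarrow> ('h, 'h op) tensor" where
  "\<psi> \<equiv> psi \<Delta> \<sigma>"

lemma comult_linear: "cq_linear \<Delta>"
  using comult_hom by (simp add: cq_algebra_hom_def)

lemma comult_one: "\<Delta> 1 = 1 \<otimes> 1"
  using comult_hom by (simp add: cq_algebra_hom_def one_tensor_def)

lemma comult_mult: "\<Delta> (u * v) = \<Delta> u * \<Delta> v"
  using comult_hom by (simp add: cq_algebra_hom_def)

lemmas comult_lin [lin_intros] = cq_linear_compose[OF comult_linear]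
lemmas antipode_lin [lin_intros] = cq_linear_compose[OF antipode_linear]

lemma counit_lin [lin_intros]: "cq_linear g \<Longrightarrow> cq_linear (\<lambda>x. \<epsilon> (g x) *\<^sub>q c)"
  by (simp add: cq_linear_def counit_add counit_scale scaleq_left_distrib scaleq_scaleq)

lemma adj_lin_left [lin_intros]: "cq_linear g \<Longrightarrow> cq_linear (\<lambda>x. AD (g x) c)"
  unfolding adj_def by (intro lin_intros)

lemma adj_lin_right [lin_intros]: "cq_linear g \<Longrightarrow> cq_linear (\<lambda>x. AD a (g x))"
  unfolding adj_def by (intro lin_intros)

lemma psi_lin [lin_intros]: "cq_linear g \<Longrightarrow> cq_linear (\<lambda>x. \<psi> (g x))"
  unfolding psi_def by (intro lin_intros)

lemma sw_one: "cq_bilinear f \<Longrightarrow> sw f 1 = f 1 1"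
  by (simp add: comult_one tlift_tens)

text \<open>\<open>?G\<close> evaluates the trilinear \<open>f\<close> on H \<otimes> (H \<otimes>
  H), and \<open>coassoc\<close> is pushed through it. Nested \<open>sw\<close> stand for iterated
  comultiplications, and this rule moves their brackets.\<close>

lemma sw_coassoc:
  assumes "\<And>b c. cq_linear (\<lambda>a. f a b c)" "\<And>a c. cq_linear (\<lambda>b. f a b c)"
    "\<And>a b. cq_linear (\<lambda>c. f a b c)"
  shows "sw (\<lambda>w c. sw (\<lambda>a b. f a b c) w) u = sw (\<lambda>a w. sw (\<lambda>b c. f a b c) w) u"
proof -
  note f = cq_linear_compose[OF assms(1)] cq_linear_compose[OF assms(2)] cq_linear_compose[OF assms(3)]
  let ?G = "tlift (\<lambda>a w. tlift (\<lambda>b c. f a b c) w)"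
  have bil: "cq_bilinear (\<lambda>b c. f a b c)" for a by (intro lin_intros f)
  have G: "cq_linear ?G" by (intro lin_intros f)
  have G_tens: "?G (a \<otimes> w) = tlift (f a) w" for a w
    by (rule tlift_tens) (intro lin_intros f)
  have "?G (tassoc z) = tlift (\<lambda>w c. tlift (\<lambda>a b. f a b c) w) z" for z
    unfolding tassoc_def linear_tlift[OF G] G_tens by (simp only: tlift_tens[OF bil])
  moreover have "?G (tmap id \<Delta> (\<Delta> u)) = sw (\<lambda>a w. sw (\<lambda>b c. f a b c) w) u"
    unfolding id_def by (rule tlift_tmap) (intro lin_intros f)+
  moreover have "tlift (\<lambda>w c. tlift (\<lambda>a b. f a b c) w) (tmap \<Delta> id (\<Delta> u))
      = sw (\<lambda>w c. sw (\<lambda>a b. f a b c) w) u"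
    unfolding id_def by (rule tlift_tmap) (intro lin_intros f)+
  ultimately show ?thesis using coassoc[of u] by metis
qed

lemma sw_mult:
  assumes "cq_bilinear f"
  shows "sw f (u * v) = sw (\<lambda>a b. sw (\<lambda>c d. f (a * c) (b * d)) v) u"
  unfolding comult_mult times_tensor_def
  by (simp only: linear_tlift[OF cq_linear_tlift[OF assms]] tlift_tens[OF assms])

lemma sw_counit_left: "cq_linear f \<Longrightarrow> sw (\<lambda>a b. \<epsilon> a *\<^sub>q f b) u = f u"
  using arg_cong[OF counit_left[of u], of f] by (simp add: linear_tlift cq_linearD)

lemma sw_counit_right: "cq_linear f \<Longrightarrow> sw (\<lambda>a b. \<epsilon> b *\<^sub>q f a) u = f u"
  using arg_cong[OF counit_right[of u], of f] by (simp add: linear_tlift cq_linearD)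

lemma sw_antipode_left: "cq_linear f \<Longrightarrow> sw (\<lambda>a b. f (\<sigma> a * b)) u = \<epsilon> u *\<^sub>q f 1"
  using arg_cong[OF antipode_left[of u], of f] by (simp add: linear_tlift cq_linearD)

lemma sw_antipode_right: "cq_linear f \<Longrightarrow> sw (\<lambda>a b. f (a * \<sigma> b)) u = \<epsilon> u *\<^sub>q f 1"
  using arg_cong[OF antipode_right[of u], of f] by (simp add: linear_tlift cq_linearD)

text \<open>The threefold sum is bracketed to the right, so a cancelling pair in the last two places
  collapses at once, while a pair in the first two places has to be rebracketed by
  coassociativity.\<close>

lemma sw_cancel:
  assumes "cq_bilinear f"
  shows "sw (\<lambda>a w. sw (\<lambda>b c. f (\<sigma> a * b) c) w) u = f 1 u"
    and "sw (\<lambda>a w. sw (\<lambda>b c. f (a * \<sigma> b) c) w) u = f 1 u"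
    and "sw (\<lambda>a w. sw (\<lambda>b c. f a (\<sigma> b * c)) w) u = f u 1"
    and "sw (\<lambda>a w. sw (\<lambda>b c. f a (b * \<sigma> c)) w) u = f u 1"
proof -
  note f = cq_bilinearD[OF assms]
  note fl = cq_linear_compose[OF f(1)] cq_linear_compose[OF f(2)]
  have "sw (\<lambda>a w. sw (\<lambda>b c. f (\<sigma> a * b) c) w) u = sw (\<lambda>w c. sw (\<lambda>a b. f (\<sigma> a * b) c) w) u"
    by (rule sw_coassoc[symmetric]) (intro lin_intros fl)+
  then show "sw (\<lambda>a w. sw (\<lambda>b c. f (\<sigma> a * b) c) w) u = f 1 u"
    by (simp add: sw_antipode_left[OF f(1)] sw_counit_left[OF f(2)])
  have "sw (\<lambda>a w. sw (\<lambda>b c. f (a * \<sigma> b) c) w) u = sw (\<lambda>w c. sw (\<lambda>a b. f (a * \<sigma> b) c) w) u"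
    by (rule sw_coassoc[symmetric]) (intro lin_intros fl)+
  then show "sw (\<lambda>a w. sw (\<lambda>b c. f (a * \<sigma> b) c) w) u = f 1 u"
    by (simp add: sw_antipode_right[OF f(1)] sw_counit_left[OF f(2)])
  show "sw (\<lambda>a w. sw (\<lambda>b c. f a (\<sigma> b * c)) w) u = f u 1"
    "sw (\<lambda>a w. sw (\<lambda>b c. f a (b * \<sigma> c)) w) u = f u 1"
    by (simp_all add: sw_antipode_left[OF f(2)] sw_antipode_right[OF f(2)] sw_counit_right[OF f(1)])
qed

section \<open>The antipode reverses products and coproducts\<close>

lemma antipode_one: "\<sigma> 1 = 1"
  using antipode_left[of 1] sw_one[of "\<lambda>a b. \<sigma> a * b"] lin_intros
  by (simp add: counit_one scaleq_one cq_bilinearI antipode_linear cq_linear_mult_left cq_linear_mult_right cq_linear_id)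

text \<open>Uniqueness of convolution inverses: \<open>\<sigma> v * \<sigma> u\<close> is a left
  inverse and \<open>\<sigma> (u * v)\<close> a right inverse of the multiplication map.
  \<open>?G\<close> is the convolution product of all three, and it is contracted from both
  ends.\<close>

lemma antipode_mult: "\<sigma> (u * v) = \<sigma> v * \<sigma> u"
proof -
  let ?G = "\<lambda>a b1 b2 c d1 d2. \<sigma> c * (\<sigma> a * b1) * d1 * \<sigma> (b2 * d2)"
  have "sw (\<lambda>a b. sw (\<lambda>b1 b2. sw (\<lambda>c d. sw (\<lambda>d1 d2. ?G a b1 b2 c d1 d2) d) v) b) u
      = sw (\<lambda>c d. sw (\<lambda>d1 d2. \<sigma> c * 1 * d1 * \<sigma> (u * d2)) d) v"
    by (rule sw_cancel(1)[where f = "\<lambda>x y. sw (\<lambda>c d. sw (\<lambda>d1 d2. \<sigma> c * x * d1 * \<sigma> (y * d2)) d) v"])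
      (intro lin_intros)
  also have "\<dots> = 1 * \<sigma> (u * v)"
    unfolding mult_1_right by (rule sw_cancel(1)) (intro lin_intros)
  finally have 1: "sw (\<lambda>a b. sw (\<lambda>b1 b2. sw (\<lambda>c d. sw (\<lambda>d1 d2. ?G a b1 b2 c d1 d2) d) v) b) u
      = \<sigma> (u * v)" by simp
  have bil: "cq_bilinear (\<lambda>x y. z * (x * \<sigma> y))" for z by (intro lin_intros)
  have lin: "cq_linear (\<lambda>x. z * x)" for z :: 'h by (intro lin_intros)
  have lin': "cq_linear (\<lambda>x. \<sigma> x * z)" for z :: 'h by (intro lin_intros)
  have inner: "sw (\<lambda>b1 b2. sw (\<lambda>d1 d2. ?G a b1 b2 c d1 d2) d) b = \<epsilon> d *\<^sub>q (\<epsilon> b *\<^sub>q (\<sigma> c * \<sigma> a))" for a b c d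
    using sw_mult[OF bil[of "\<sigma> c * \<sigma> a"], of b d] sw_antipode_right[OF lin[of "\<sigma> c * \<sigma> a"], of "b * d"]
    by (simp add: mult.assoc counit_mult scaleq_scaleq mult.commute)
  have "sw (\<lambda>a b. sw (\<lambda>b1 b2. sw (\<lambda>c d. sw (\<lambda>d1 d2. ?G a b1 b2 c d1 d2) d) v) b) u
     = sw (\<lambda>a b. sw (\<lambda>c d. sw (\<lambda>b1 b2. sw (\<lambda>d1 d2. ?G a b1 b2 c d1 d2) d) b) v) u"
    by (subst tlift_swap) (rule refl)
  also have "\<dots> = sw (\<lambda>a b. sw (\<lambda>c d. \<epsilon> d *\<^sub>q (\<epsilon> b *\<^sub>q (\<sigma> c * \<sigma> a))) v) u"
    by (simp only: inner)
  also have "\<dots> = sw (\<lambda>a b. \<epsilon> b *\<^sub>q (\<sigma> v * \<sigma> a)) u"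
  proof -
    have "sw (\<lambda>c d. \<epsilon> d *\<^sub>q (\<epsilon> b *\<^sub>q (\<sigma> c * \<sigma> a))) v = \<epsilon> b *\<^sub>q (\<sigma> v * \<sigma> a)" for a b
      by (rule sw_counit_right) (intro lin_intros)
    then show ?thesis by simp
  qed
  also have "\<dots> = \<sigma> v * \<sigma> u"
    by (rule sw_counit_right) (intro lin_intros)
  finally show ?thesis using 1 by simp
qed

text \<open>Again uniqueness of convolution inverses, now for maps from H to H \<otimes> H:
  \<open>R\<close> is a left inverse of \<open>\<Delta>\<close>, and \<Delta> after \<sigma> is a
  right inverse.\<close>

lemma antipode_comult: "\<Delta> (\<sigma> u) = sw (\<lambda>a b. \<sigma> b \<otimes> \<sigma> a) u"
proof -
  define R where "R = (\<lambda>u. sw (\<lambda>a b. \<sigma> b \<otimes> \<sigma> a) u)"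
  have R_lin: "cq_linear g \<Longrightarrow> cq_linear (\<lambda>x. R (g x))" for g :: "'h \<Rightarrow> 'h"
    unfolding R_def by (intro lin_intros)
  have inner: "sw (\<lambda>a c. R a * \<Delta> c) w = \<epsilon> w *\<^sub>q 1" for w
  proof -
    have "R a * \<Delta> c = sw (\<lambda>e1 e2. sw (\<lambda>c1 c2. (\<sigma> e2 * c1) \<otimes> (\<sigma> e1 * c2)) c) a" for a c
      unfolding R_def by (subst tlift_tens_id[of "\<Delta> c", symmetric])
        (simp only: tlift_mult_left tlift_mult_right tensor_mult_tens, rule tlift_swap)
    then have "sw (\<lambda>a c. R a * \<Delta> c) w
        = sw (\<lambda>a c. sw (\<lambda>e1 e2. sw (\<lambda>c1 c2. (\<sigma> e2 * c1) \<otimes> (\<sigma> e1 * c2)) c) a) w" by simp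
    also have "\<dots> = sw (\<lambda>e1 v. sw (\<lambda>e2 c. sw (\<lambda>c1 c2. (\<sigma> e2 * c1) \<otimes> (\<sigma> e1 * c2)) c) v) w"
      by (rule sw_coassoc) (intro lin_intros)+
    also have "\<dots> = sw (\<lambda>e1 v. 1 \<otimes> (\<sigma> e1 * v)) w"
    proof -
      have "sw (\<lambda>e2 c. sw (\<lambda>c1 c2. (\<sigma> e2 * c1) \<otimes> (\<sigma> e1 * c2)) c) v = 1 \<otimes> (\<sigma> e1 * v)" for e1 v
        by (rule sw_cancel(1)[where f = "\<lambda>x y. x \<otimes> (\<sigma> e1 * y)"]) (intro lin_intros)
      then show ?thesis by simp
    qed
    also have "\<dots> = \<epsilon> w *\<^sub>q (1 \<otimes> 1)"
      by (rule sw_antipode_left) (intro lin_intros)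
    finally show ?thesis by (simp add: one_tensor_def)
  qed
  \<comment> \<open>The sum is evaluated in two ways: collapsing \<open>c * \<sigma> d\<close>
    leaves \<open>R u\<close>, collapsing \<open>R a * \<Delta> c\<close> leaves
    \<open>\<Delta> (\<sigma> u)\<close>.\<close>
  have "sw (\<lambda>a b. sw (\<lambda>c d. R a * \<Delta> (c * \<sigma> d)) b) u = R u * \<Delta> 1"
    by (rule sw_cancel(4)) (intro lin_intros R_lin)
  moreover have "sw (\<lambda>a b. sw (\<lambda>c d. R a * \<Delta> (c * \<sigma> d)) b) u
      = sw (\<lambda>w d. sw (\<lambda>a c. R a * \<Delta> (c * \<sigma> d)) w) u"
    by (rule sw_coassoc[symmetric]) (intro lin_intros R_lin)+
  moreover have "\<dots> = sw (\<lambda>w d. sw (\<lambda>a c. R a * \<Delta> c) w * \<Delta> (\<sigma> d)) u"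
    by (simp add: comult_mult mult.assoc tlift_mult_left)
  moreover have "\<dots> = sw (\<lambda>w d. \<epsilon> w *\<^sub>q \<Delta> (\<sigma> d)) u"
    unfolding inner by (simp add: mult_scaleq_left)
  moreover have "\<dots> = \<Delta> (\<sigma> u)"
    by (rule sw_counit_left) (intro lin_intros)
  ultimately have "\<Delta> (\<sigma> u) = R u" by (simp add: comult_one flip: one_tensor_def)
  then show ?thesis by (simp add: R_def)
qed

subsection \<open>The adjoint action\<close>

lemma adj_one_left: "AD 1 b = b"
  unfolding adj_def by (subst sw_one) (intro lin_intros, simp add: antipode_one)

lemma adj_one_right: "AD a 1 = \<epsilon> a *\<^sub>q 1"
  unfolding adj_def by (simp add: antipode_right)

lemma adj_mult_left: "AD (a * a') b = AD a (AD a' b)"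
proof -
  have "AD (a * a') b = sw (\<lambda>p q. sw (\<lambda>c d. p * c * b * \<sigma> (q * d)) a') a"
    unfolding adj_def by (rule sw_mult) (intro lin_intros)
  then show ?thesis
    unfolding adj_def by (simp add: antipode_mult tlift_mult_left tlift_mult_right mult.assoc)
qed

lemma adj_mult_right: "AD a (b * c) = sw (\<lambda>p q. AD p b * AD q c) a"
proof -
  have "AD p b * AD q c = sw (\<lambda>p1 p2. sw (\<lambda>q1 q2. p1 * b * (\<sigma> p2 * q1) * c * \<sigma> q2) q) p" for p q
    unfolding adj_def by (simp only: tlift_mult_left tlift_mult_right mult.assoc) (rule tlift_swap)
  then have "sw (\<lambda>p q. AD p b * AD q c) a
      = sw (\<lambda>p q. sw (\<lambda>p1 p2. sw (\<lambda>q1 q2. p1 * b * (\<sigma> p2 * q1) * c * \<sigma> q2) q) p) a"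
    by simp
  also have "\<dots> = sw (\<lambda>p1 w. sw (\<lambda>p2 q. sw (\<lambda>q1 q2. p1 * b * (\<sigma> p2 * q1) * c * \<sigma> q2) q) w) a"
    by (rule sw_coassoc) (intro lin_intros)+
  also have "\<dots> = sw (\<lambda>p1 w. p1 * (b * c) * \<sigma> w) a"
  proof -
    have "sw (\<lambda>p2 q. sw (\<lambda>q1 q2. p1 * b * (\<sigma> p2 * q1) * c * \<sigma> q2) q) w = p1 * b * 1 * c * \<sigma> w" for p1 w
      by (rule sw_cancel(1)[where f = "\<lambda>x y. p1 * b * x * c * \<sigma> y"]) (intro lin_intros)
    then show ?thesis by (simp add: mult.assoc)
  qed
  finally show ?thesis unfolding adj_def ..
qed

text \<open>After expanding the adjoint action, \<open>\<sigma> u(2) * u(3)\<close> cancels.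
  Together with its counterpart \<open>mult_antipode_adj\<close> for \<open>\<sigma> u\<close>, this
  moves the two legs of psi(u) past a tensor.\<close>

lemma mult_adj: "u * b = sw (\<lambda>p r. AD p b * r) u"
proof -
  have "sw (\<lambda>p r. AD p b * r) u = sw (\<lambda>p r. sw (\<lambda>p1 p2. p1 * b * (\<sigma> p2 * r)) p) u"
    unfolding adj_def by (simp only: tlift_mult_left mult.assoc)
  also have "\<dots> = sw (\<lambda>p1 w. sw (\<lambda>p2 r. p1 * b * (\<sigma> p2 * r)) w) u"
    by (rule sw_coassoc) (intro lin_intros)+
  also have "\<dots> = u * b * 1"
    by (rule sw_cancel(3)) (intro lin_intros)
  finally show ?thesis by simp
qed

lemma mult_antipode_adj: "c * \<sigma> u = sw (\<lambda>r s. \<sigma> r * AD s c) u"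
proof -
  have "sw (\<lambda>r s. \<sigma> r * AD s c) u = sw (\<lambda>r s. sw (\<lambda>s1 s2. \<sigma> r * s1 * c * \<sigma> s2) s) u"
    unfolding adj_def by (simp only: tlift_mult_right mult.assoc)
  also have "\<dots> = 1 * c * \<sigma> u"
    by (rule sw_cancel(1)[where f = "\<lambda>x y. x * c * \<sigma> y"]) (intro lin_intros)
  finally show ?thesis by simp
qed

text \<open>This expresses (1 \<otimes> ad a) (\<Delta> b) through the values of \<Delta> on the orbit of b, which is why
  the locally finite part is a left coideal.\<close>

lemma comult_adj:
  "tmap id (AD a) (\<Delta> b) = sw (\<lambda>p w. sw (\<lambda>r s. (\<sigma> p \<otimes> 1) * \<Delta> (AD r b) * (s \<otimes> 1)) w) a"
proof -
  have right: "sw (\<lambda>q s. \<Delta> (\<sigma> q) * (s \<otimes> 1)) r = 1 \<otimes> \<sigma> r" for r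
  proof -
    have "sw (\<lambda>q s. \<Delta> (\<sigma> q) * (s \<otimes> 1)) r = sw (\<lambda>q s. sw (\<lambda>q1 q2. (\<sigma> q2 * s) \<otimes> \<sigma> q1) q) r"
      unfolding antipode_comult by (simp add: tlift_mult_left tensor_mult_tens)
    also have "\<dots> = sw (\<lambda>q1 w. sw (\<lambda>q2 s. (\<sigma> q2 * s) \<otimes> \<sigma> q1) w) r"
      by (rule sw_coassoc) (intro lin_intros)+
    also have "\<dots> = 1 \<otimes> \<sigma> r"
      by (rule sw_cancel(3)) (intro lin_intros)
    finally show ?thesis .
  qed
  have left: "sw (\<lambda>a p. (\<sigma> a \<otimes> 1) * \<Delta> p) v = 1 \<otimes> v" for v
  proof -
    have "(\<sigma> a \<otimes> 1) * \<Delta> p = sw (\<lambda>p1 p2. (\<sigma> a * p1) \<otimes> p2) p" for a p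
      by (subst tlift_tens_id[of "\<Delta> p", symmetric]) (simp add: tlift_mult_right tensor_mult_tens)
    then have "sw (\<lambda>a p. (\<sigma> a \<otimes> 1) * \<Delta> p) v = sw (\<lambda>a p. sw (\<lambda>p1 p2. (\<sigma> a * p1) \<otimes> p2) p) v" by simp
    also have "\<dots> = 1 \<otimes> v"
      by (rule sw_cancel(1)) (intro lin_intros)
    finally show ?thesis .
  qed
  \<comment> \<open>Here \<Delta>(ad r b) expands to the sum of \<Delta>(r(1)) \<Delta>(b)
    \<Delta>(\<sigma> r(2)). The outer factors cancel the first legs of \<Delta>(r(1)) and
    \<Delta>(\<sigma> r(2)), so that multiplication acts on the second leg of \<Delta> b
    alone.\<close>
  have "sw (\<lambda>p w. sw (\<lambda>r s. (\<sigma> p \<otimes> 1) * \<Delta> (AD r b) * (s \<otimes> 1)) w) a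
      = sw (\<lambda>p w. sw (\<lambda>r s. sw (\<lambda>r1 r2. (\<sigma> p \<otimes> 1) * \<Delta> r1 * \<Delta> b * (\<Delta> (\<sigma> r2) * (s \<otimes> 1))) r) w) a"
    unfolding adj_def linear_tlift[OF comult_linear]
    by (simp only: tlift_mult_left tlift_mult_right comult_mult mult.assoc)
  also have "\<dots> = sw (\<lambda>p w. sw (\<lambda>r1 z. sw (\<lambda>r2 s. (\<sigma> p \<otimes> 1) * \<Delta> r1 * \<Delta> b * (\<Delta> (\<sigma> r2) * (s \<otimes> 1))) z) w) a"
  proof -
    have "sw (\<lambda>r s. sw (\<lambda>r1 r2. (\<sigma> p \<otimes> 1) * \<Delta> r1 * \<Delta> b * (\<Delta> (\<sigma> r2) * (s \<otimes> 1))) r) w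
        = sw (\<lambda>r1 z. sw (\<lambda>r2 s. (\<sigma> p \<otimes> 1) * \<Delta> r1 * \<Delta> b * (\<Delta> (\<sigma> r2) * (s \<otimes> 1))) z) w" for p w
      by (rule sw_coassoc) (intro lin_intros)+
    then show ?thesis by simp
  qed
  also have "\<dots> = sw (\<lambda>p w. sw (\<lambda>r1 z. (\<sigma> p \<otimes> 1) * \<Delta> r1 * \<Delta> b * (1 \<otimes> \<sigma> z)) w) a"
    by (simp only: tlift_mult_right[symmetric] right)
  also have "\<dots> = sw (\<lambda>v z. sw (\<lambda>p r1. (\<sigma> p \<otimes> 1) * \<Delta> r1 * \<Delta> b * (1 \<otimes> \<sigma> z)) v) a"
    by (rule sw_coassoc[symmetric]) (intro lin_intros)+
  also have "\<dots> = sw (\<lambda>v z. (1 \<otimes> v) * \<Delta> b * (1 \<otimes> \<sigma> z)) a"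
    by (simp only: tlift_mult_left[symmetric] left)
  also have "\<dots> = sw (\<lambda>v z. tlift (\<lambda>b1 b2. b1 \<otimes> (v * b2 * \<sigma> z)) (\<Delta> b)) a"
  proof -
    have "(1 \<otimes> v) * \<Delta> b * (1 \<otimes> \<sigma> z) = tlift (\<lambda>b1 b2. b1 \<otimes> (v * b2 * \<sigma> z)) (\<Delta> b)" for v z
      by (subst tlift_tens_id[of "\<Delta> b", symmetric])
        (simp add: tlift_mult_left tlift_mult_right tensor_mult_tens)
    then show ?thesis by simp
  qed
  also have "\<dots> = tlift (\<lambda>b1 b2. sw (\<lambda>v z. b1 \<otimes> (v * b2 * \<sigma> z)) a) (\<Delta> b)"
    by (rule tlift_swap)
  also have "\<dots> = tmap id (AD a) (\<Delta> b)"
    unfolding tmap_def adj_def by (simp add: tlift_tens_right)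
  finally show ?thesis ..
qed

section \<open>The embedding psi and its commutation rule\<close>

lemma psi_one: "\<psi> 1 = 1"
  unfolding psi_def one_tensor_def one_op_def
  by (subst sw_one) (intro lin_intros, simp add: antipode_one)

lemma psi_mult: "\<psi> (u * v) = \<psi> u * \<psi> v"
proof -
  have "\<psi> (u * v) = sw (\<lambda>a b. sw (\<lambda>c d. (a * c) \<otimes> Op (\<sigma> (b * d))) v) u"
    unfolding psi_def by (rule sw_mult) (intro lin_intros)
  then show ?thesis
    unfolding psi_def
    by (simp add: tlift_mult_left tlift_mult_right tensor_mult_tens times_op_def antipode_mult)
      (rule tlift_swap)
qed

text \<open>The multiplication of U^op places \<sigma> of the second leg of \<open>\<psi> r\<close>
  to the left of \<open>AD s c\<close>, which is the form required by
  \<open>mult_antipode_adj\<close>; the first leg is then absorbed by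
  \<open>mult_adj\<close>.\<close>

lemma psi_commute:
  "\<psi> u * (b \<otimes> Op c) = sw (\<lambda>p q. sw (\<lambda>r s. (AD p b \<otimes> Op (AD s c)) * \<psi> r) q) u"
proof -
  have "sw (\<lambda>p q. sw (\<lambda>r s. (AD p b \<otimes> Op (AD s c)) * \<psi> r) q) u
     = sw (\<lambda>p q. sw (\<lambda>r s. sw (\<lambda>r1 r2. (AD p b * r1) \<otimes> Op (\<sigma> r2 * AD s c)) r) q) u"
    unfolding psi_def by (simp add: tlift_mult_right tensor_mult_tens times_op_def)
  also have "\<dots> = sw (\<lambda>p q. sw (\<lambda>r1 w. sw (\<lambda>r2 s. (AD p b * r1) \<otimes> Op (\<sigma> r2 * AD s c)) w) q) u"
  proof -
    have "sw (\<lambda>r s. sw (\<lambda>r1 r2. (AD p b * r1) \<otimes> Op (\<sigma> r2 * AD s c)) r) q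
        = sw (\<lambda>r1 w. sw (\<lambda>r2 s. (AD p b * r1) \<otimes> Op (\<sigma> r2 * AD s c)) w) q" for p q
      by (rule sw_coassoc) (intro lin_intros)+
    then show ?thesis by simp
  qed
  also have "\<dots> = sw (\<lambda>p q. sw (\<lambda>r1 w. (AD p b * r1) \<otimes> Op (c * \<sigma> w)) q) u"
    by (simp only: mult_antipode_adj[of c] tlift_Op tlift_tens_right)
  also have "\<dots> = sw (\<lambda>v w. sw (\<lambda>p r1. (AD p b * r1) \<otimes> Op (c * \<sigma> w)) v) u"
    by (rule sw_coassoc[symmetric]) (intro lin_intros)+
  also have "\<dots> = sw (\<lambda>v w. (v * b) \<otimes> Op (c * \<sigma> w)) u"
    by (simp only: mult_adj[of _ b] tlift_tens_left)
  also have "\<dots> = \<psi> u * (b \<otimes> Op c)"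
    unfolding psi_def by (simp add: tlift_mult_left tensor_mult_tens times_op_def)
  finally show ?thesis ..
qed

end

section \<open>Locally finite parts\<close>

text \<open>The scalars \<open>ratfun\<close> are not an instance of \<open>cq_vector\<close>, so
  \<open>cq_linear\<close> does not apply to functionals; they enter linear maps as coefficients, as
  in \<open>\<phi> x *\<^sub>q c\<close>.\<close>

definition cq_functional :: "('a::cq_vector \<Rightarrow> ratfun) \<Rightarrow> bool" where
  "cq_functional \<phi> \<longleftrightarrow> (\<forall>x y. \<phi> (x + y) = \<phi> x + \<phi> y) \<and> (\<forall>c x. \<phi> (c *\<^sub>q x) = c * \<phi> x)"

lemma cq_functional_lin: "cq_functional \<phi> \<Longrightarrow> cq_linear g \<Longrightarrow> cq_linear (\<lambda>x. \<phi> (g x) *\<^sub>q c)"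
  by (simp add: cq_linear_def cq_functional_def scaleq_left_distrib scaleq_scaleq)

lemma dual_family_exists:
  assumes "\<And>j. j \<in> I \<Longrightarrow> a j \<notin> cq.span (a ` (I - {j}))"
  obtains \<phi> where "\<And>j. j \<in> I \<Longrightarrow> cq_functional (\<phi> j)"
    "\<And>i j. j \<in> I \<Longrightarrow> i \<in> I \<Longrightarrow> \<phi> j (a i) = (if i = j then 1 else 0)"
proof -
  have "\<exists>\<phi>. cq_functional \<phi> \<and> (\<forall>i\<in>I. \<phi> (a i) = (if i = j then 1 else 0))" if j: "j \<in> I" for j
  proof -
    obtain \<phi> where "cq_functional \<phi>" "\<phi> (a j) = 1" "\<And>x. x \<in> a ` (I - {j}) \<Longrightarrow> \<phi> x = 0"
      using dual_functional_exists[OF assms[OF j]] unfolding cq_functional_def by metis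
    then show ?thesis by (intro exI[of _ \<phi>]) auto
  qed
  then show ?thesis using that by metis
qed

text \<open>In a tensor sum of minimal length both families of factors are linearly independent, so every
  single factor is recovered by contracting with a functional on the other side.\<close>

lemma tensor_sum_slices:
  fixes z :: "('a::cq_vector, 'b::cq_vector) tensor"
  obtains I :: "nat set" and a b \<phi> \<chi>
  where "finite I" "z = (\<Sum>i\<in>I. a i \<otimes> b i)"
    "\<forall>j\<in>I. cq_functional (\<phi> j)" "\<forall>j\<in>I. cq_functional (\<chi> j)"
    "\<forall>j\<in>I. \<forall>f :: 'b \<Rightarrow> 'b. cq_linear f \<longrightarrow> tlift (\<lambda>x y. \<phi> j x *\<^sub>q f y) z = f (b j)"
    "\<forall>j\<in>I. \<forall>f :: 'a \<Rightarrow> 'a. cq_linear f \<longrightarrow> tlift (\<lambda>x y. \<chi> j y *\<^sub>q f x) z = f (a j)"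
proof -
  obtain I :: "nat set" and a b where fin: "finite I" and z: "z = (\<Sum>i\<in>I. a i \<otimes> b i)"
    and a: "\<And>j. j \<in> I \<Longrightarrow> a j \<notin> cq.span (a ` (I - {j}))"
    and b: "\<And>j. j \<in> I \<Longrightarrow> b j \<notin> cq.span (b ` (I - {j}))"
    by (rule minimal_tensor_sum[of z]) blast
  obtain \<phi> where \<phi>: "\<And>j. j \<in> I \<Longrightarrow> cq_functional (\<phi> j)"
    "\<And>i j. j \<in> I \<Longrightarrow> i \<in> I \<Longrightarrow> \<phi> j (a i) = (if i = j then 1 else 0)"
    by (rule dual_family_exists[OF a]) blast+
  obtain \<chi> where \<chi>: "\<And>j. j \<in> I \<Longrightarrow> cq_functional (\<chi> j)"
    "\<And>i j. j \<in> I \<Longrightarrow> i \<in> I \<Longrightarrow> \<chi> j (b i) = (if i = j then 1 else 0)"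
    by (rule dual_family_exists[OF b]) blast+
  have delta: "(\<Sum>i\<in>I. (if i = j then 1 else 0) *\<^sub>q g i) = g j"
    if "j \<in> I" for g :: "nat \<Rightarrow> 'c::cq_vector" and j
  proof -
    have "(\<Sum>i\<in>I. (if i = j then 1 else 0) *\<^sub>q g i) = (\<Sum>i\<in>I. if i = j then g i else 0)"
      by (rule sum.cong) (auto simp: scaleq_one)
    then show ?thesis using that fin by simp
  qed
  show ?thesis
  proof (rule that[OF fin z]; intro ballI allI impI)
    fix j assume "j \<in> I"
    then show "cq_functional (\<phi> j)" "cq_functional (\<chi> j)" by (rule \<phi>(1), rule \<chi>(1))
  next
    fix j and f :: "'b \<Rightarrow> 'b" assume j: "j \<in> I" and f: "cq_linear f"
    have bil: "cq_bilinear (\<lambda>x y. \<phi> j x *\<^sub>q f y)"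
      by (intro lin_intros cq_functional_lin \<phi>(1)[OF j] f)
    have "tlift (\<lambda>x y. \<phi> j x *\<^sub>q f y) z = (\<Sum>i\<in>I. \<phi> j (a i) *\<^sub>q f (b i))"
      by (simp add: z cq_linear_sum[OF cq_linear_tlift[OF bil]] tlift_tens[OF bil])
    also have "\<dots> = f (b j)" using delta[OF j, of "\<lambda>i. f (b i)"] \<phi>(2)[OF j] by simp
    finally show "tlift (\<lambda>x y. \<phi> j x *\<^sub>q f y) z = f (b j)" .
  next
    fix j and f :: "'a \<Rightarrow> 'a" assume j: "j \<in> I" and f: "cq_linear f"
    have bil: "cq_bilinear (\<lambda>x y. \<chi> j y *\<^sub>q f x)"
      by (intro lin_intros cq_functional_lin \<chi>(1)[OF j] f)
    have "tlift (\<lambda>x y. \<chi> j y *\<^sub>q f x) z = (\<Sum>i\<in>I. \<chi> j (b i) *\<^sub>q f (a i))"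
      by (simp add: z cq_linear_sum[OF cq_linear_tlift[OF bil]] tlift_tens[OF bil])
    also have "\<dots> = f (a j)" using delta[OF j, of "\<lambda>i. f (a i)"] \<chi>(2)[OF j] by simp
    finally show "tlift (\<lambda>x y. \<chi> j y *\<^sub>q f x) z = f (a j)" .
  qed
qed

lemma bilinear_in_span:
  assumes "cq_bilinear f" "x \<in> cq.span B" "y \<in> cq.span C"
  shows "f x y \<in> cq.span {f b c | b c. b \<in> B \<and> c \<in> C}"
proof (rule cq_linear_span_image[OF cq_bilinearD(1)[OF assms(1)] assms(2)])
  fix b assume "b \<in> B"
  show "f b y \<in> cq.span {f b c | b c. b \<in> B \<and> c \<in> C}"
    by (rule cq_linear_span_image[OF cq_bilinearD(2)[OF assms(1)] assms(3)])
      (use \<open>b \<in> B\<close> in \<open>auto intro!: cq.span_base\<close>)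
qed simp

text \<open>Stated for arbitrary \<open>\<Delta>\<close> and \<open>\<sigma>\<close>, as are the
  following rules on \<open>locally_finite_part\<close>, so that they serve U and U \<otimes> U^op
  alike; the latter is never interpreted as a \<open>hopf_algebra\<close>.\<close>

lemma adj_linear: "cq_linear (adj \<Delta> \<sigma> a)"
  unfolding adj_def by (intro lin_intros)

lemma locally_finite_partI:
  "finite B \<Longrightarrow> (\<And>a. adj \<Delta> \<sigma> a v \<in> cq.span B) \<Longrightarrow> v \<in> locally_finite_part \<Delta> \<sigma>"
  unfolding locally_finite_part_def by blast

lemma locally_finite_partE:
  assumes "v \<in> locally_finite_part \<Delta> \<sigma>"
  obtains B where "finite B" "\<And>a. adj \<Delta> \<sigma> a v \<in> cq.span B"
  using assms unfolding locally_finite_part_def by blast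

lemma subspace_locally_finite_part: "cq.subspace (locally_finite_part \<Delta> \<sigma>)"
proof (rule cq.subspaceI)
  show "0 \<in> locally_finite_part \<Delta> \<sigma>"
    by (rule locally_finite_partI[of "{}"]) (simp_all add: cq_linearD[OF adj_linear])
next
  fix v w assume "v \<in> locally_finite_part \<Delta> \<sigma>" "w \<in> locally_finite_part \<Delta> \<sigma>"
  then obtain B C where "finite B" "\<And>a. adj \<Delta> \<sigma> a v \<in> cq.span B"
    "finite C" "\<And>a. adj \<Delta> \<sigma> a w \<in> cq.span C" by (metis locally_finite_partE)
  then show "v + w \<in> locally_finite_part \<Delta> \<sigma>"
    by (intro locally_finite_partI[of "B \<union> C"])
      (auto simp: cq_linearD[OF adj_linear] intro!: cq.span_add intro: cq.span_mono[THEN subsetD, rotated])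
next
  fix c v assume "v \<in> locally_finite_part \<Delta> \<sigma>"
  then obtain B where "finite B" "\<And>a. adj \<Delta> \<sigma> a v \<in> cq.span B" by (metis locally_finite_partE)
  then show "c *\<^sub>q v \<in> locally_finite_part \<Delta> \<sigma>"
    by (intro locally_finite_partI[of B]) (auto simp: cq_linearD[OF adj_linear] cq.span_scale)
qed

context hopf_algebra
begin

lemmas LF_closed = cq.subspace_0[OF subspace_locally_finite_part]
  cq.subspace_add[OF subspace_locally_finite_part]
  cq.subspace_scale[OF subspace_locally_finite_part]

lemma LF_one: "1 \<in> LF"
  by (rule locally_finite_partI[of "{1}"]) (auto simp: adj_one_right intro: cq.span_scale cq.span_base)

lemma LF_adj:
  assumes "b \<in> LF"
  shows "AD a b \<in> LF"
proof -
  from assms obtain B where "finite B" "\<And>a. AD a b \<in> cq.span B" by (metis locally_finite_partE)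
  then show ?thesis by (intro locally_finite_partI[of B]) (simp_all flip: adj_mult_left)
qed

lemma LF_mult:
  assumes "b \<in> LF" "c \<in> LF"
  shows "b * c \<in> LF"
proof -
  from assms obtain B C where B: "finite B" "\<And>a. AD a b \<in> cq.span B"
    and C: "finite C" "\<And>a. AD a c \<in> cq.span C" by (metis locally_finite_partE)
  let ?S = "{x * y | x y. x \<in> B \<and> y \<in> C}"
  have "cq_bilinear ((*) :: 'h \<Rightarrow> 'h \<Rightarrow> 'h)" by (intro lin_intros)
  then have "AD a (b * c) \<in> cq.span ?S" for a
    unfolding adj_mult_right
    by (intro tlift_in_subspace bilinear_in_span B C) simp
  then show ?thesis using B(1) C(1)
    by (intro locally_finite_partI[of ?S] finite_image_set2) auto
qed

text \<open>By \<open>comult_adj\<close>, applying \<open>AD a\<close> to a right factor of \<Delta>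
  b gives a combination of slices of \<Delta> w, twisted by factors on the left legs, with w in the
  orbit of b. That orbit lies in the span of a finite set \<open>B\<close>, so the right factors of
  the finitely many \<Delta> e with e in \<open>B\<close> span a space containing all the
  results.\<close>

lemma comult_LF:
  assumes "b \<in> LF"
  obtains I :: "nat set" and p q where "finite I" "\<Delta> b = (\<Sum>i\<in>I. p i \<otimes> q i)" "\<And>i. i \<in> I \<Longrightarrow> q i \<in> LF"
proof -
  obtain I :: "nat set" and p q \<phi> \<chi> where I: "finite I" "\<Delta> b = (\<Sum>i\<in>I. p i \<otimes> q i)"
    and \<phi>: "\<forall>j\<in>I. cq_functional (\<phi> j)" and "\<forall>j\<in>I. cq_functional (\<chi> j)"
    and slice: "\<forall>j\<in>I. \<forall>f :: 'h \<Rightarrow> 'h. cq_linear f \<longrightarrow> sw (\<lambda>x y. \<phi> j x *\<^sub>q f y) b = f (q j)"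
    and "\<forall>j\<in>I. \<forall>f :: 'h \<Rightarrow> 'h. cq_linear f \<longrightarrow> sw (\<lambda>x y. \<chi> j y *\<^sub>q f x) b = f (p j)"
    by (rule tensor_sum_slices[of "\<Delta> b"])
  from assms obtain B where B: "finite B" "\<And>a. AD a b \<in> cq.span B" by (metis locally_finite_partE)
  have "\<exists>R. finite R \<and> (\<exists>N u v. \<Delta> e = (\<Sum>i<(N::nat). u i \<otimes> v i) \<and> R = v ` {..<N})" for e
    using tensor_sum_exists[of "\<Delta> e"] by (metis finite_imageI finite_lessThan)
  then obtain R where R: "\<And>e. finite (R e)"
    "\<And>e. \<exists>N u v. \<Delta> e = (\<Sum>i<(N::nat). u i \<otimes> v i) \<and> R e = v ` {..<N}" by metis
  let ?W = "cq.span (\<Union>e\<in>B. R e)"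
  have "q j \<in> LF" if j: "j \<in> I" for j
  proof (rule locally_finite_partI)
    show "finite (\<Union>e\<in>B. R e)" using B(1) R(1) by blast
    fix a
    let ?s = "tlift (\<lambda>x y. \<phi> j x *\<^sub>q y)"
    have bil: "cq_bilinear (\<lambda>x y. \<phi> j x *\<^sub>q y)"
      by (intro lin_intros cq_functional_lin \<phi>[rule_format, OF j])
    note s_lin = cq_linear_compose[OF cq_linear_tlift[OF bil]]
    \<comment> \<open>Multiplication by \<open>x \<otimes> 1\<close> and
      \<open>y \<otimes> 1\<close> changes left factors only, which the functional turns into
      scalars.\<close>
    have W: "?s ((x \<otimes> 1) * \<Delta> w * (y \<otimes> 1)) \<in> ?W" if "w \<in> cq.span B" for w x y
    proof (rule cq_linear_span_image[OF _ that])
      show "cq_linear (\<lambda>w. ?s ((x \<otimes> 1) * \<Delta> w * (y \<otimes> 1)))" by (intro s_lin lin_intros)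
      fix e assume e: "e \<in> B"
      obtain N u v where "\<Delta> e = (\<Sum>i<(N::nat). u i \<otimes> v i)" and Re: "R e = v ` {..<N}"
        using R(2) by metis
      then have "?s ((x \<otimes> 1) * \<Delta> e * (y \<otimes> 1)) = (\<Sum>i<N. \<phi> j (x * u i * y) *\<^sub>q v i)"
        by (simp add: sum_distrib_left sum_distrib_right tensor_mult_tens
            cq_linear_sum[OF cq_linear_tlift[OF bil]] tlift_tens[OF bil])
      also have "\<dots> \<in> ?W"
        using e Re by (intro cq.span_sum cq.span_scale cq.span_base) auto
      finally show "?s ((x \<otimes> 1) * \<Delta> e * (y \<otimes> 1)) \<in> ?W" .
    qed simp
    \<comment> \<open>The slice property is used with \<open>f\<close> equal to \<open>AD a\<close>,
      which replaces \<open>q j\<close> by its image.\<close>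
    have "AD a (q j) = ?s (tmap id (AD a) (\<Delta> b))"
      using slice[rule_format, OF j adj_linear[of \<Delta> \<sigma> a]]
      by (simp add: tlift_tmap[OF bil] adj_linear id_def cq_linear_id)
    also have "\<dots> = sw (\<lambda>p w. sw (\<lambda>r s. ?s ((\<sigma> p \<otimes> 1) * \<Delta> (AD r b) * (s \<otimes> 1))) w) a"
      unfolding comult_adj by (simp add: linear_tlift[OF cq_linear_tlift[OF bil]])
    also have "\<dots> \<in> ?W"
      by (intro tlift_in_subspace W B(2)) simp_all
    finally show "AD a (q j) \<in> ?W" .
  qed
  with I show ?thesis using that by blast
qed

end

subsection \<open>The tensor product with the opposite algebra\<close>

text \<open>\<open>antipode_op\<close> is built from \<open>inv \<sigma>\<close>, which bijectivity
  makes a linear two-sided inverse. The assumption is verified for U in the last section.\<close>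

locale bijective_hopf_algebra = hopf_algebra \<Delta> \<epsilon> \<sigma>
  for \<Delta> :: "'h::cq_algebra \<Rightarrow> ('h, 'h) tensor" and \<epsilon> \<sigma> +
  assumes bij_antipode: "bij \<sigma>"
begin

abbreviation env_adj where
  "env_adj \<equiv> adj (comult_tensor \<Delta> (comult_op \<Delta>)) (tmap \<sigma> (antipode_op \<sigma>))"

lemma inv_antipode: "inv \<sigma> (\<sigma> u) = u" "\<sigma> (inv \<sigma> u) = u"
  using bij_antipode by (simp_all add: bij_is_inj bij_is_surj surj_f_inv_f)

lemma cq_linear_inv_antipode: "cq_linear (inv \<sigma>)"
proof (rule cq_linearI)
  fix x y c
  have "\<sigma> (inv \<sigma> x + inv \<sigma> y) = x + y" "\<sigma> (c *\<^sub>q inv \<sigma> x) = c *\<^sub>q x"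
    by (simp_all add: cq_linearD[OF antipode_linear] inv_antipode)
  then show "inv \<sigma> (x + y) = inv \<sigma> x + inv \<sigma> y" "inv \<sigma> (c *\<^sub>q x) = c *\<^sub>q inv \<sigma> x"
    by (metis inv_antipode(1))+
qed

lemma antipode_op_lin [lin_intros]: "cq_linear g \<Longrightarrow> cq_linear (\<lambda>x. antipode_op \<sigma> (g x))"
  unfolding antipode_op_def by (intro lin_intros cq_linear_compose[OF cq_linear_inv_antipode])

lemma comult_op_lin [lin_intros]: "cq_linear g \<Longrightarrow> cq_linear (\<lambda>x. comult_op \<Delta> (g x))"
  unfolding comult_op_def by (intro lin_intros)

lemma comult_tensor_lin [lin_intros]:
  "cq_linear g \<Longrightarrow> cq_linear (\<lambda>x. comult_tensor \<Delta> (comult_op \<Delta>) (g x))"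
  unfolding comult_tensor_def tswap_mid_def by (intro lin_intros)

lemma env_adj_lin [lin_intros]: "cq_linear g \<Longrightarrow> cq_linear (\<lambda>x. env_adj (g x) v)"
  unfolding adj_def by (intro lin_intros)

text \<open>As \<Delta>(\<sigma> a) is the sum of the \<sigma> a(2) \<otimes> \<sigma> a(1), the
  inverse antipode restores a(1), and the reversed product puts it to the left of b. Since \<sigma>
  is onto, U and U^op therefore have the same adjoint orbits.\<close>

lemma adj_op: "adj (comult_op \<Delta>) (antipode_op \<sigma>) (Op (\<sigma> a)) (Op b) = Op (AD a b)"
proof -
  have "adj (comult_op \<Delta>) (antipode_op \<sigma>) (Op (\<sigma> a)) (Op b)
      = tlift (\<lambda>a1 a2. Op a1 * Op b * antipode_op \<sigma> (Op a2)) (\<Delta> (\<sigma> a))"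
    unfolding adj_def comult_op_def op.sel
    by (rule tlift_tmap) (intro lin_intros)+
  also have "\<dots> = tlift (\<lambda>a1 a2. Op (inv \<sigma> a2 * b * a1)) (\<Delta> (\<sigma> a))"
    by (simp add: antipode_op_def times_op_def mult.assoc)
  also have "\<dots> = sw (\<lambda>a b'. Op (inv \<sigma> (\<sigma> a) * b * \<sigma> b')) a"
  proof -
    have bil: "cq_bilinear (\<lambda>a1 a2. Op (inv \<sigma> a2 * b * a1))"
      by (intro lin_intros cq_linear_compose[OF cq_linear_inv_antipode])
    show ?thesis
      unfolding antipode_comult linear_tlift[OF cq_linear_tlift[OF bil]] tlift_tens[OF bil] ..
  qed
  finally show ?thesis by (simp add: inv_antipode adj_def tlift_Op)
qed

lemma env_adj_tens:
  "env_adj (a \<otimes> Op (\<sigma> c)) (b \<otimes> Op d) = AD a b \<otimes> Op (AD c d)"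
proof -
  let ?f = "\<lambda>z w. z * (b \<otimes> Op d) * tmap \<sigma> (antipode_op \<sigma>) w"
  have f: "cq_bilinear ?f" by (intro lin_intros antipode_linear)
  have mid: "tswap_mid (v \<otimes> w) = tlift (\<lambda>a b. tlift (\<lambda>c d. (a \<otimes> c) \<otimes> (b \<otimes> d)) w) v"
    for v :: "('h, 'h) tensor" and w :: "('h op, 'h op) tensor"
    unfolding tswap_mid_def by (rule tlift_tens) (intro lin_intros)
  have "tmap \<Delta> (comult_op \<Delta>) (a \<otimes> Op (\<sigma> c)) = \<Delta> a \<otimes> comult_op \<Delta> (Op (\<sigma> c))"
    by (rule tmap_tens) (intro lin_intros)+
  moreover have "tmap \<sigma> (antipode_op \<sigma>) (x \<otimes> y) = \<sigma> x \<otimes> antipode_op \<sigma> y" for x y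
    by (rule tmap_tens) (intro lin_intros)+
  ultimately have "env_adj (a \<otimes> Op (\<sigma> c)) (b \<otimes> Op d)
      = sw (\<lambda>a1 a2. tlift (\<lambda>c1 c2. (a1 * b * \<sigma> a2) \<otimes> (c1 * Op d * antipode_op \<sigma> c2))
          (comult_op \<Delta> (Op (\<sigma> c)))) a"
    unfolding adj_def comult_tensor_def
    by (simp add: mid linear_tlift[OF cq_linear_tlift[OF f]] tlift_tens[OF f] tensor_mult_tens)
  also have "\<dots> = AD a b \<otimes> adj (comult_op \<Delta>) (antipode_op \<sigma>) (Op (\<sigma> c)) (Op d)"
    unfolding adj_def by (simp only: tlift_tens_left tlift_tens_right) (rule tlift_swap)
  finally show ?thesis by (simp add: adj_op)
qed

text \<open>The orbit of b \<otimes> c lies in the span of products of the two orbits. Conversely,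
  acting with \<open>u \<otimes> 1\<close> or \<open>1 \<otimes> Op (\<sigma> u)\<close> moves only
  one side of a shortest tensor sum for v, and contracting the other side bounds the orbit of each
  single factor by a finite-dimensional slice of the orbit of v.\<close>

lemma F_env_eq: "F_env \<Delta> \<sigma> = cq.span {b \<otimes> Op c | b c. b \<in> LF \<and> c \<in> LF}"
proof (rule antisym)
  show "cq.span {b \<otimes> Op c | b c. b \<in> LF \<and> c \<in> LF} \<subseteq> F_env \<Delta> \<sigma>"
    unfolding F_env_def
  proof (rule cq.span_minimal[OF _ subspace_locally_finite_part], safe)
    fix b c assume "b \<in> LF" "c \<in> LF"
    then obtain B C where B: "finite B" "\<And>a. AD a b \<in> cq.span B"
      and C: "finite C" "\<And>a. AD a c \<in> cq.span C" by (metis locally_finite_partE)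
    let ?S = "{x \<otimes> Op y | x y. x \<in> B \<and> y \<in> C}"
    have "cq_bilinear (\<lambda>x y. x \<otimes> Op y :: ('h, 'h op) tensor)" by (intro lin_intros)
    note S = bilinear_in_span[OF this B(2) C(2)]
    show "b \<otimes> Op c \<in> locally_finite_part (comult_tensor \<Delta> (comult_op \<Delta>)) (tmap \<sigma> (antipode_op \<sigma>))"
    proof (rule locally_finite_partI)
      show "finite ?S" using B(1) C(1) by (intro finite_image_set2) auto
      have lin: "cq_linear (\<lambda>z. env_adj z (b \<otimes> Op c))" by (intro lin_intros)
      show "env_adj z (b \<otimes> Op c) \<in> cq.span ?S" for z
      proof (induction z rule: tensor_induct)
        case (tens a a')
        \<comment> \<open>Surjectivity of the antipode puts every right factor into the form
          required by \<open>env_adj_tens\<close>.\<close>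
        have "a' = Op (\<sigma> (inv \<sigma> (unop a')))" by (simp add: inv_antipode)
        then show ?case using S[of a "inv \<sigma> (unop a')"] env_adj_tens[of a "inv \<sigma> (unop a')" b c] by simp
      next
        case (add x y)
        then show ?case by (simp add: cq_linearD[OF lin] cq.span_add)
      qed
    qed
  qed
next
  show "F_env \<Delta> \<sigma> \<subseteq> cq.span {b \<otimes> Op c | b c. b \<in> LF \<and> c \<in> LF}"
  proof
    fix v assume "v \<in> F_env \<Delta> \<sigma>"
    then obtain B where B: "finite B" "\<And>z. env_adj z v \<in> cq.span B"
      unfolding F_env_def by (metis locally_finite_partE)
    obtain I :: "nat set" and a b \<phi> \<chi> where fin: "finite I" and v: "v = (\<Sum>i\<in>I. a i \<otimes> b i)"
      and \<phi>: "\<forall>j\<in>I. cq_functional (\<phi> j)" and \<chi>: "\<forall>j\<in>I. cq_functional (\<chi> j)"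
      and b: "\<forall>j\<in>I. \<forall>f :: 'h op \<Rightarrow> 'h op. cq_linear f \<longrightarrow> tlift (\<lambda>x y. \<phi> j x *\<^sub>q f y) v = f (b j)"
      and a: "\<forall>j\<in>I. \<forall>f :: 'h \<Rightarrow> 'h. cq_linear f \<longrightarrow> tlift (\<lambda>x y. \<chi> j y *\<^sub>q f x) v = f (a j)"
      by (rule tensor_sum_slices[of v])
    have a_LF: "a j \<in> LF" if j: "j \<in> I" for j
    proof (rule locally_finite_partI)
      let ?s = "tlift (\<lambda>x y. \<chi> j y *\<^sub>q x)"
      have bil: "cq_bilinear (\<lambda>x y. \<chi> j y *\<^sub>q x)"
        by (intro lin_intros cq_functional_lin \<chi>[rule_format, OF j])
      show "finite (?s ` B)" using B(1) by simp
      fix u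
      have "env_adj (u \<otimes> 1) v = tmap (AD u) (\<lambda>y. y) v"
      proof (rule tensor_eqI[of "env_adj (u \<otimes> 1)" "tmap (AD u) (\<lambda>y. y)"])
        show "env_adj (u \<otimes> 1) (x \<otimes> y) = tmap (AD u) (\<lambda>y. y) (x \<otimes> y)" for x y
          using env_adj_tens[of u 1 x "unop y"]
          by (simp add: tmap_tens adj_linear cq_linear_id antipode_one adj_one_left one_op_def)
      qed (intro adj_linear lin_intros)+
      then have "AD u (a j) = ?s (env_adj (u \<otimes> 1) v)"
        using a[rule_format, OF j adj_linear[of \<Delta> \<sigma> u]]
        by (simp add: tlift_tmap[OF bil] adj_linear cq_linear_id)
      also have "\<dots> \<in> cq.span (?s ` B)"
        by (rule cq_linear_span_image[OF cq_linear_tlift[OF bil] B(2)]) (auto intro: cq.span_base)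
      finally show "AD u (a j) \<in> cq.span (?s ` B)" .
    qed
    have b_LF: "unop (b j) \<in> LF" if j: "j \<in> I" for j
    proof (rule locally_finite_partI)
      let ?s = "tlift (\<lambda>x y. \<phi> j x *\<^sub>q y)"
      have bil: "cq_bilinear (\<lambda>x y. \<phi> j x *\<^sub>q y)"
        by (intro lin_intros cq_functional_lin \<phi>[rule_format, OF j])
      show "finite (unop ` ?s ` B)" using B(1) by simp
      fix u
      let ?g = "\<lambda>y. Op (AD u (unop y))"
      have g: "cq_linear ?g" by (intro lin_intros)
      have "env_adj (1 \<otimes> Op (\<sigma> u)) v = tmap (\<lambda>x. x) ?g v"
      proof (rule tensor_eqI[of "env_adj (1 \<otimes> Op (\<sigma> u))" "tmap (\<lambda>x. x) ?g"])
        show "env_adj (1 \<otimes> Op (\<sigma> u)) (x \<otimes> y) = tmap (\<lambda>x. x) ?g (x \<otimes> y)" for x y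
          using env_adj_tens[of 1 u x "unop y"]
          by (simp add: tmap_tens[OF cq_linear_id g] adj_one_left)
      qed (intro adj_linear lin_intros)+
      then have "?g (b j) = ?s (env_adj (1 \<otimes> Op (\<sigma> u)) v)"
        using b[rule_format, OF j g] by (simp add: tlift_tmap[OF bil cq_linear_id g])
      also have "\<dots> \<in> cq.span (?s ` B)"
        by (rule cq_linear_span_image[OF cq_linear_tlift[OF bil] B(2)]) (auto intro: cq.span_base)
      finally have "unop (?g (b j)) \<in> cq.span (unop ` ?s ` B)"
        by (rule cq_linear_span_image[rotated]) (auto intro: cq.span_base lin_intros)
      then show "AD u (unop (b j)) \<in> cq.span (unop ` ?s ` B)" by simp
    qed
    have "a i \<otimes> b i \<in> {b \<otimes> Op c | b c. b \<in> LF \<and> c \<in> LF}" if "i \<in> I" for i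
      using a_LF[OF that] b_LF[OF that] by (metis (mono_tags, lifting) mem_Collect_eq op.collapse)
    then show "v \<in> cq.span {b \<otimes> Op c | b c. b \<in> LF \<and> c \<in> LF}"
      unfolding v by (intro cq.span_sum cq.span_base)
  qed
qed

end

section \<open>Modules and compatible bimodules\<close>

lemma cq_linear_eq_on_span:
  assumes "cq_linear f" "cq_linear g" "x \<in> cq.span B" "\<And>b. b \<in> B \<Longrightarrow> f b = g b"
  shows "f x = g x"
  using cq_linear_span_image[OF cq_linear_diff[OF assms(1,2)] assms(3), of "{0}"] assms(4)
  by (simp add: cq.subspace_def)

lemma projection_exists:
  fixes S :: "'a::cq_vector set"
  assumes "cq.subspace S"
  obtains \<pi> :: "'a \<Rightarrow> 'a" where "cq_linear \<pi>" "\<And>x. \<pi> x \<in> S" "\<And>x. x \<in> S \<Longrightarrow> \<pi> x = x"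
proof -
  interpret P: vector_space_pair "scaleq :: ratfun \<Rightarrow> 'a \<Rightarrow> 'a" "scaleq :: ratfun \<Rightarrow> 'a \<Rightarrow> 'a" ..
  \<comment> \<open>A linear left inverse on \<open>S\<close> of the identity map, with range in
    \<open>S\<close>, is a projection onto \<open>S\<close>.\<close>
  have "\<exists>g. g ` UNIV \<subseteq> S \<and> Vector_Spaces.linear scaleq scaleq g \<and> (\<forall>v\<in>S. g (id v) = v)"
    by (rule P.linear_exists_left_inverse_on[OF cq.linear_id assms]) simp
  then obtain \<pi> where \<pi>: "Vector_Spaces.linear scaleq scaleq \<pi>" "\<And>x. \<pi> x \<in> S" "\<And>v. v \<in> S \<Longrightarrow> \<pi> v = v"
    by auto
  then interpret L: Vector_Spaces.linear "scaleq :: ratfun \<Rightarrow> 'a \<Rightarrow> 'a" scaleq \<pi> by simp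
  show ?thesis by (rule that[OF _ \<pi>(2,3)]) (simp_all add: cq_linear_def L.add L.scale)
qed

lemma bilinear_actionD:
  assumes "bilinear_action_on S act"
  shows "a \<in> S \<Longrightarrow> cq_linear (act a)"
    and "a \<in> S \<Longrightarrow> b \<in> S \<Longrightarrow> act (a + b) m = act a m + act b m"
    and "a \<in> S \<Longrightarrow> act (c *\<^sub>q a) m = c *\<^sub>q act a m"
    and "a \<notin> S \<Longrightarrow> act a = undefined"
  using assms by (auto simp: bilinear_action_on_def extensional_def)

lemma action_lin_vec:
  "bilinear_action_on S act \<Longrightarrow> a \<in> S \<Longrightarrow> cq_linear g \<Longrightarrow> cq_linear (\<lambda>x. act a (g x))"
  by (rule cq_linear_compose[OF bilinear_actionD(1)])

lemma action_lin_arg: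
  assumes "bilinear_action_on S act" "\<And>x. g x \<in> S" "cq_linear g"
  shows "cq_linear (\<lambda>x. act (g x) m)"
  using assms(3) by (simp add: cq_linear_def bilinear_actionD[OF assms(1)] assms(2))

lemma action_zero:
  assumes "bilinear_action_on S act" "cq.subspace S"
  shows "act 0 m = 0"
  using bilinear_actionD(3)[OF assms(1) cq.subspace_0[OF assms(2)], of 0 m] by simp

lemma action_sum:
  assumes "bilinear_action_on S act" "cq.subspace S" "\<And>i. i \<in> I \<Longrightarrow> f i \<in> S"
  shows "act (\<Sum>i\<in>I. f i) m = (\<Sum>i\<in>I. act (f i) m)"
  using assms(3)
  by (induction I rule: infinite_finite_induct)
    (simp_all add: action_zero[OF assms(1,2)] bilinear_actionD(2)[OF assms(1)] cq.subspace_sum[OF assms(2)])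

lemma action_sum_list:
  assumes "bilinear_action_on S act" "cq.subspace S" "\<And>i. i \<in> set xs \<Longrightarrow> f i \<in> S"
  shows "(\<Sum>i\<leftarrow>xs. f i) \<in> S \<and> act (\<Sum>i\<leftarrow>xs. f i) m = (\<Sum>i\<leftarrow>xs. act (f i) m)"
  using assms(3)
  by (induction xs)
    (simp_all add: action_zero[OF assms(1,2)] bilinear_actionD(2)[OF assms(1)]
      cq.subspace_0[OF assms(2)] cq.subspace_add[OF assms(2)])

lemma action_tlift:
  assumes "bilinear_action_on S act" "cq.subspace S" "\<And>a b. f a b \<in> S"
  shows "act (tlift f z) m = tlift (\<lambda>a b. act (f a b) m) z"
  by (simp add: tlift_def lin_ext_def case_prod_beta action_sum[OF assms(1,2)]
      cq.subspace_scale[OF assms(2)] bilinear_actionD(3)[OF assms(1)] assms(3))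

context hopf_algebra
begin

text \<open>In U^op, multiplying by \<open>Op q\<close> on the left puts \<open>q\<close> to the
  right of \<open>\<sigma> p2\<close>, so the last two Sweedler factors cancel.\<close>

lemma psi_recover: "sw (\<lambda>p q. (1 \<otimes> Op q) * \<psi> p) a = a \<otimes> 1"
proof -
  have "sw (\<lambda>p q. (1 \<otimes> Op q) * \<psi> p) a = sw (\<lambda>p q. sw (\<lambda>p1 p2. p1 \<otimes> Op (\<sigma> p2 * q)) p) a"
    unfolding psi_def by (simp add: tlift_mult_right tensor_mult_tens times_op_def)
  also have "\<dots> = sw (\<lambda>p1 w. sw (\<lambda>p2 q. p1 \<otimes> Op (\<sigma> p2 * q)) w) a"
    by (rule sw_coassoc) (intro lin_intros)+
  also have "\<dots> = a \<otimes> Op 1"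
    by (rule sw_cancel(3)) (intro lin_intros)
  finally show ?thesis by (simp add: one_op_def)
qed

text \<open>Bridges two bracketings: \<open>compatible_ad_action\<close> splits the first factor of
  \<Delta> again, \<open>psi_commute\<close> the second.\<close>

lemma sw_threefold:
  assumes "\<And>b c. cq_linear (\<lambda>a. f a b c)" "\<And>a c. cq_linear (\<lambda>b. f a b c)"
    "\<And>a b. cq_linear (\<lambda>c. f a b c)"
  shows "tlift (\<lambda>w c. tlift (\<lambda>a b. f a b c) w) (tmap \<Delta> id (\<Delta> u)) = sw (\<lambda>a w. sw (\<lambda>b c. f a b c) w) u"
proof -
  note f = cq_linear_compose[OF assms(1)] cq_linear_compose[OF assms(2)] cq_linear_compose[OF assms(3)]
  have "tlift (\<lambda>w c. tlift (\<lambda>a b. f a b c) w) (tmap \<Delta> id (\<Delta> u)) = sw (\<lambda>w c. sw (\<lambda>a b. f a b c) w) u"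
    unfolding id_def by (rule tlift_tmap) (intro lin_intros f)+
  then show ?thesis by (simp add: sw_coassoc[OF assms])
qed

lemma threefold_action:
  assumes l: "bilinear_action_on LF l" and r: "bilinear_action_on LF r"
    and ad: "bilinear_action_on UNIV ad" and bc: "b \<in> LF" "c \<in> LF"
  shows "tlift (\<lambda>w a3. tlift (\<lambda>a1 a2. r (AD a3 c) (l (AD a1 b) (ad a2 m))) w) (tmap \<Delta> id (\<Delta> a))
    = sw (\<lambda>a1 w. sw (\<lambda>a2 a3. r (AD a3 c) (l (AD a1 b) (ad a2 m))) w) a"
  by (rule sw_threefold)
    (intro lin_intros action_lin_vec[OF r] action_lin_vec[OF l] action_lin_arg[OF r]
      action_lin_arg[OF l] action_lin_arg[OF ad] LF_adj bc UNIV_I)+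

end

section \<open>The subalgebra F(U \<otimes> U^op) psi(U) and its modules\<close>

context bijective_hopf_algebra
begin

abbreviation \<A> :: "('h, 'h op) tensor set" where
  "\<A> \<equiv> F_env_psi \<Delta> \<sigma>"

lemma F_env_psi_eq: "\<A> = cq.span {(b \<otimes> Op c) * \<psi> u | b c u. b \<in> LF \<and> c \<in> LF}"
proof (rule antisym)
  show "\<A> \<subseteq> cq.span {(b \<otimes> Op c) * \<psi> u | b c u. b \<in> LF \<and> c \<in> LF}"
    unfolding F_env_psi_def
  proof (rule cq.span_minimal[OF _ cq.subspace_span], safe)
    fix f u assume "f \<in> F_env \<Delta> \<sigma>"
    then have f: "f \<in> cq.span {b \<otimes> Op c | b c. b \<in> LF \<and> c \<in> LF}" by (simp add: F_env_eq)
    have lin: "cq_linear (\<lambda>f. f * \<psi> u)" by (intro lin_intros)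
    show "f * \<psi> u \<in> cq.span {(b \<otimes> Op c) * \<psi> u | b c u. b \<in> LF \<and> c \<in> LF}"
      by (rule cq_linear_span_image[OF lin f]) (auto intro!: cq.span_base)
  qed
  show "cq.span {(b \<otimes> Op c) * \<psi> u | b c u. b \<in> LF \<and> c \<in> LF} \<subseteq> \<A>"
    unfolding F_env_psi_def F_env_eq
  proof (rule cq.span_mono, safe)
    fix b c u assume "b \<in> LF" "c \<in> LF"
    then have "b \<otimes> Op c \<in> cq.span {b \<otimes> Op c | b c. b \<in> LF \<and> c \<in> LF}"
      by (auto intro!: cq.span_base)
    then show "\<exists>f v. (b \<otimes> Op c) * \<psi> u = f * \<psi> v \<and> f \<in> cq.span {b \<otimes> Op c | b c. b \<in> LF \<and> c \<in> LF}"
      by (intro exI[of _ "b \<otimes> Op c"] exI[of _ u]) simp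
  qed
qed

lemma subspace_F_env_psi: "cq.subspace \<A>"
  unfolding F_env_psi_def by (rule cq.subspace_span)

lemma F_env_psi_base: "b \<in> LF \<Longrightarrow> c \<in> LF \<Longrightarrow> (b \<otimes> Op c) * \<psi> u \<in> \<A>"
  unfolding F_env_psi_eq by (rule cq.span_base) blast

lemma F_env_psi_gens:
  "b \<in> LF \<Longrightarrow> b \<otimes> 1 \<in> \<A>" "c \<in> LF \<Longrightarrow> 1 \<otimes> Op c \<in> \<A>" "\<psi> u \<in> \<A>" "1 \<in> \<A>"
  using F_env_psi_base[of b 1 1] F_env_psi_base[of 1 c 1] F_env_psi_base[of 1 1 u] F_env_psi_base[of 1 1 1]
  by (simp_all add: LF_one psi_one flip: one_op_def one_tensor_def)

text \<open>Straightening rule: \<open>\<psi> u\<close> is carried past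
  \<open>b' \<otimes> Op c'\<close> by \<open>psi_commute\<close>. It gives closure of
  \<open>\<A>\<close> under products and later the multiplicativity of the constructed
  action.\<close>

lemma F_env_psi_base_mult:
  "((b \<otimes> Op c) * \<psi> u) * ((b' \<otimes> Op c') * \<psi> v)
    = sw (\<lambda>p q. sw (\<lambda>s t. ((b * AD p b') \<otimes> Op (AD t c' * c)) * \<psi> (s * v)) q) u"
proof -
  have "((b \<otimes> Op c) * \<psi> u) * ((b' \<otimes> Op c') * \<psi> v) = (b \<otimes> Op c) * (\<psi> u * (b' \<otimes> Op c')) * \<psi> v"
    by (simp add: mult.assoc)
  also have "\<dots> = sw (\<lambda>p q. sw (\<lambda>s t. ((b \<otimes> Op c) * (AD p b' \<otimes> Op (AD t c'))) * (\<psi> s * \<psi> v)) q) u"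
    unfolding psi_commute by (simp only: tlift_mult_left tlift_mult_right mult.assoc)
  finally show ?thesis by (simp add: tensor_mult_tens times_op_def psi_mult)
qed

lemma F_env_psi_mult:
  assumes "z \<in> \<A>" "w \<in> \<A>"
  shows "z * w \<in> \<A>"
proof -
  have base: "((b \<otimes> Op c) * \<psi> u) * ((b' \<otimes> Op c') * \<psi> v) \<in> \<A>"
    if "b \<in> LF" "c \<in> LF" "b' \<in> LF" "c' \<in> LF" for b c u b' c' v
    unfolding F_env_psi_base_mult
    by (intro tlift_in_subspace subspace_F_env_psi F_env_psi_base LF_mult LF_adj that)
  have "cq_bilinear ((*) :: ('h, 'h op) tensor \<Rightarrow> _)" by (intro lin_intros)
  from bilinear_in_span[OF this assms[unfolded F_env_psi_eq]]
  show ?thesis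
    by (rule subsetD[OF cq.span_minimal[OF _ subspace_F_env_psi], rotated]) (auto intro: base)
qed

lemma restrict_action_compatible:
  fixes act :: "('h, 'h op) tensor \<Rightarrow> 'm::cq_vector \<Rightarrow> 'm"
  assumes "left_module_on \<A> act"
  shows "restrict_action \<Delta> \<sigma> act \<in> compatible_bimodules \<Delta> \<sigma>"
proof -
  have bil: "bilinear_action_on \<A> act" and act_one: "act 1 m = m"
    and act_mult: "z \<in> \<A> \<Longrightarrow> w \<in> \<A> \<Longrightarrow> act (z * w) m = act z (act w m)" for z w m
    using assms by (auto simp: left_module_on_def)
  let ?l = "restrict (\<lambda>b. act (b \<otimes> 1)) LF" and ?r = "restrict (\<lambda>c. act (1 \<otimes> Op c)) LF"
    and ?ad = "\<lambda>a. act (\<psi> a)"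
  note gens = F_env_psi_gens
  note act_lin = bilinear_actionD[OF bil]
  have ad: "bilinear_action_on UNIV ?ad"
    unfolding bilinear_action_on_def
    using cq_linearD[OF psi_lin[OF cq_linear_id]] by (simp add: act_lin gens)
  have l: "bilinear_action_on LF ?l"
    unfolding bilinear_action_on_def
    by (simp add: act_lin gens LF_closed tens_add_left tens_scale_left)
  have "1 \<otimes> Op (b + c) = 1 \<otimes> Op b + (1 \<otimes> Op c :: ('h, 'h op) tensor)"
    "1 \<otimes> Op (k *\<^sub>q c) = k *\<^sub>q (1 \<otimes> Op c :: ('h, 'h op) tensor)" for b c k
    by (simp_all add: plus_op_def scaleq_op_def flip: tens_add_right tens_scale_right)
  then have r: "bilinear_action_on LF ?r"
    unfolding bilinear_action_on_def by (simp add: act_lin gens LF_closed)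
  have l_module: "left_module_on LF ?l"
    unfolding left_module_on_def using l
    by (simp add: LF_one LF_mult act_one gens tensor_mult_tens flip: one_tensor_def act_mult)
  have r_module: "right_module_on LF ?r"
    unfolding right_module_on_def using r
    by (simp add: LF_one LF_mult act_one gens tensor_mult_tens times_op_def
        flip: one_tensor_def one_op_def act_mult)
  have commute: "act (1 \<otimes> Op c) (act (b \<otimes> 1) m) = act (b \<otimes> Op c) m"
    "act (b \<otimes> 1) (act (1 \<otimes> Op c) m) = act (b \<otimes> Op c) m" if "b \<in> LF" "c \<in> LF" for b c m
    using that by (simp_all add: gens tensor_mult_tens flip: act_mult)
  have bimodule: "bimodule_on LF ?l ?r"
    unfolding bimodule_on_def using l_module r_module by (simp add: commute)
  have ad_module: "left_module_on UNIV ?ad"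
    unfolding left_module_on_def using ad by (simp add: psi_one psi_mult act_one act_mult gens)
  have tens_mem: "b \<otimes> Op c \<in> \<A>" if "b \<in> LF" "c \<in> LF" for b c
    using F_env_psi_base[OF that, of 1] by (simp add: psi_one)
  have first: "?ad a (?r c (?l b m))
      = tlift (\<lambda>w a3. tlift (\<lambda>a1 a2. ?r (AD a3 c) (?l (AD a1 b) (?ad a2 m))) w) (tmap \<Delta> id (\<Delta> a))"
    if bc: "b \<in> LF" "c \<in> LF" for a b c m
  proof -
    have "?ad a (?r c (?l b m)) = act (\<psi> a * (b \<otimes> Op c)) m"
      using bc by (simp add: commute act_mult gens tens_mem)
    also have "\<dots> = sw (\<lambda>p q. sw (\<lambda>s t. act ((AD p b \<otimes> Op (AD t c)) * \<psi> s) m) q) a"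
      unfolding psi_commute
      by (simp add: action_tlift[OF bil subspace_F_env_psi] tlift_in_subspace[OF subspace_F_env_psi]
          F_env_psi_base LF_adj bc)
    also have "\<dots> = sw (\<lambda>p q. sw (\<lambda>s t. ?r (AD t c) (?l (AD p b) (?ad s m))) q) a"
      using bc by (simp add: act_mult gens tens_mem LF_adj commute)
    finally show ?thesis by (simp only: threefold_action[OF l r ad bc])
  qed
  have second: "(\<Sum>(a1, a2)\<leftarrow>ps. ?r a2 (?ad a1 m)) = ?l a m"
    if a: "a \<in> LF" and ps: "set ps \<subseteq> UNIV \<times> LF" "\<Delta> a = (\<Sum>(a1, a2)\<leftarrow>ps. a1 \<otimes> a2)" for a m ps
  proof -
    \<comment> \<open>\<open>tlift ?f\<close> takes the same value \<open>a \<otimes> 1\<close> on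
      every expression of \<Delta> a. Each term lies in \<open>\<A>\<close> because the right
      factors lie in F(U), so \<open>act\<close> may be applied termwise.\<close>
    let ?f = "\<lambda>p q. (1 \<otimes> Op q) * \<psi> p"
    have f: "cq_bilinear ?f" by (intro lin_intros)
    have mem: "(case x of (a1, a2) \<Rightarrow> ?f a1 a2) \<in> \<A>" if "x \<in> set ps" for x
      using that ps(1) by (auto intro!: F_env_psi_base LF_one)
    have "tlift ?f (\<Sum>(a1, a2)\<leftarrow>qs. a1 \<otimes> a2) = (\<Sum>(a1, a2)\<leftarrow>qs. ?f a1 a2)" for qs
      by (induction qs) (auto simp: cq_linearD[OF cq_linear_tlift[OF f]] tlift_tens[OF f])
    then have "(\<Sum>(a1, a2)\<leftarrow>ps. ?f a1 a2) = a \<otimes> 1"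
      using psi_recover[of a] ps(2) by simp
    then have "?l a m = act (\<Sum>(a1, a2)\<leftarrow>ps. ?f a1 a2) m" using a by simp
    also have "\<dots> = (\<Sum>x\<leftarrow>ps. act (case x of (a1, a2) \<Rightarrow> ?f a1 a2) m)"
      by (rule conjunct2[OF action_sum_list[OF bil subspace_F_env_psi mem]])
    also have "\<dots> = (\<Sum>(a1, a2)\<leftarrow>ps. ?r a2 (?ad a1 m))"
      using ps(1) by (intro arg_cong[of _ _ sum_list] map_cong) (auto simp: act_mult gens)
    finally show ?thesis by simp
  qed
  show ?thesis
    unfolding restrict_action_def compatible_bimodules_def compatible_ad_action_def
    using bimodule ad_module first second by blast
qed

text \<open>The products (1 \<otimes> c) (b \<otimes> 1) psi(u) span \<open>\<A>\<close>, and on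
  them multiplicativity reduces an action to its three restrictions. Outside \<open>\<A>\<close>
  both actions are \<open>undefined\<close>.\<close>

lemma restrict_action_inj:
  fixes act act' :: "('h, 'h op) tensor \<Rightarrow> 'm::cq_vector \<Rightarrow> 'm"
  assumes "left_module_on \<A> act" "left_module_on \<A> act'"
    and eq: "restrict_action \<Delta> \<sigma> act = restrict_action \<Delta> \<sigma> act'"
  shows "act = act'"
proof
  fix z
  have bil: "bilinear_action_on \<A> act" "bilinear_action_on \<A> act'"
    using assms by (auto simp: left_module_on_def)
  have base: "f ((b \<otimes> Op c) * \<psi> u) m = f (1 \<otimes> Op c) (f (b \<otimes> 1) (f (\<psi> u) m))"
    if f: "left_module_on \<A> f" and "b \<in> LF" "c \<in> LF"
    for f :: "('h, 'h op) tensor \<Rightarrow> 'm \<Rightarrow> 'm" and b c u m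
  proof -
    have "(b \<otimes> Op c) * \<psi> u = (1 \<otimes> Op c) * ((b \<otimes> 1) * \<psi> u)"
      by (simp add: tensor_mult_tens flip: mult.assoc)
    then show ?thesis
      using that by (simp add: left_module_on_def F_env_psi_gens F_env_psi_mult)
  qed
  have gens: "act (b \<otimes> 1) = act' (b \<otimes> 1)" "act (1 \<otimes> Op b) = act' (1 \<otimes> Op b)" "act (\<psi> u) = act' (\<psi> u)"
    if "b \<in> LF" for b u
  proof -
    have "restrict (\<lambda>b. act (b \<otimes> 1)) LF = restrict (\<lambda>b. act' (b \<otimes> 1)) LF"
      "restrict (\<lambda>c. act (1 \<otimes> Op c)) LF = restrict (\<lambda>c. act' (1 \<otimes> Op c)) LF"
      "(\<lambda>a. act (\<psi> a)) = (\<lambda>a. act' (\<psi> a))"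
      using eq by (simp_all add: restrict_action_def)
    from fun_cong[OF this(1), of b] fun_cong[OF this(2), of b] fun_cong[OF this(3), of u] that
    show "act (b \<otimes> 1) = act' (b \<otimes> 1)" "act (1 \<otimes> Op b) = act' (1 \<otimes> Op b)" "act (\<psi> u) = act' (\<psi> u)"
      by simp_all
  qed
  show "act z = act' z"
  proof (cases "z \<in> \<A>")
    case True
    \<comment> \<open>Membership is carried through the induction because the actions are known to
      be linear only on \<open>\<A>\<close>.\<close>
    then have "z \<in> \<A> \<and> act z m = act' z m" for m
      unfolding F_env_psi_eq
    proof (induction rule: cq.span_induct_alt)
      case base
      show ?case
        by (simp add: cq.span_zero action_zero[OF bil(1) subspace_F_env_psi] action_zero[OF bil(2) subspace_F_env_psi])
    next
      case (step k x y)
      then obtain b c u where x: "x = (b \<otimes> Op c) * \<psi> u" "b \<in> LF" "c \<in> LF" by blast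
      from x have xA: "x \<in> \<A>" by (simp add: F_env_psi_base)
      have y: "y \<in> \<A>" "act y m = act' y m" using step(2) by (simp_all add: F_env_psi_eq)
      have "act x m = act' x m"
        using x by (simp add: base assms(1,2) gens)
      moreover note kx = cq.subspace_scale[OF subspace_F_env_psi xA, of k]
      ultimately have "act (k *\<^sub>q x + y) m = act' (k *\<^sub>q x + y) m"
        using xA y by (simp add: bilinear_actionD[OF bil(1)] bilinear_actionD[OF bil(2)])
      then show ?case
        using cq.subspace_add[OF subspace_F_env_psi kx y(1)] by (simp add: F_env_psi_eq)
    qed
    then show ?thesis by blast
  next
    case False
    then show ?thesis by (simp add: bilinear_actionD(4)[OF bil(1)] bilinear_actionD(4)[OF bil(2)])
  qed
qed

text \<open>unpsi inverts the map sending u \<otimes> c to (1 \<otimes> c) psi(u).\<close>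

definition unpsi :: "('h, 'h op) tensor \<Rightarrow> ('h, 'h) tensor" where
  "unpsi = tlift (\<lambda>u c. sw (\<lambda>p q. p \<otimes> (q * unop c)) u)"

text \<open>Splitting \<open>b * u(1)\<close> puts \<open>u(2) * \<sigma> u(3)\<close> into the
  second leg, where it cancels. For b and c in F(U), the coideal property makes the result an
  element of U \<otimes> F(U), on which \<open>r\<close> and \<open>ad\<close> can act.\<close>

lemma unpsi_base: "unpsi ((b \<otimes> Op c) * \<psi> u) = sw (\<lambda>p q. (p * u) \<otimes> (q * c)) b"
proof -
  have bil: "cq_bilinear (\<lambda>u c. sw (\<lambda>p q. p \<otimes> (q * unop c)) u)" by (intro lin_intros)
  have "unpsi ((b \<otimes> Op c) * \<psi> u) = sw (\<lambda>u1 u2. unpsi ((b * u1) \<otimes> Op (\<sigma> u2 * c))) u"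
    unfolding psi_def unpsi_def
    by (simp add: tlift_mult_right tensor_mult_tens times_op_def linear_tlift[OF cq_linear_tlift[OF bil]])
  also have "\<dots> = sw (\<lambda>u1 u2. sw (\<lambda>p q. p \<otimes> (q * (\<sigma> u2 * c))) (b * u1)) u"
    unfolding unpsi_def tlift_tens[OF bil] by simp
  also have "\<dots> = sw (\<lambda>u1 u2. sw (\<lambda>p q. sw (\<lambda>v w. (p * v) \<otimes> (q * w * (\<sigma> u2 * c))) u1) b) u"
  proof -
    have "sw (\<lambda>p q. p \<otimes> (q * (\<sigma> u2 * c))) (b * u1)
        = sw (\<lambda>p q. sw (\<lambda>v w. (p * v) \<otimes> (q * w * (\<sigma> u2 * c))) u1) b" for u1 u2
      by (rule sw_mult) (intro lin_intros)
    then show ?thesis by simp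
  qed
  also have "\<dots> = sw (\<lambda>p q. sw (\<lambda>u1 u2. sw (\<lambda>v w. (p * v) \<otimes> (q * w * (\<sigma> u2 * c))) u1) u) b"
    by (rule tlift_swap)
  also have "\<dots> = sw (\<lambda>p q. (p * u) \<otimes> (q * c)) b"
  proof -
    have "sw (\<lambda>u1 u2. sw (\<lambda>v w. (p * v) \<otimes> (q * w * (\<sigma> u2 * c))) u1) u = (p * u) \<otimes> (q * c)" for p q
    proof -
      have "sw (\<lambda>u1 u2. sw (\<lambda>v w. (p * v) \<otimes> (q * w * (\<sigma> u2 * c))) u1) u
          = sw (\<lambda>v z. sw (\<lambda>w u2. (p * v) \<otimes> (q * w * (\<sigma> u2 * c))) z) u"
        by (rule sw_coassoc) (intro lin_intros)+
      also have "\<dots> = sw (\<lambda>v z. sw (\<lambda>w u2. (p * v) \<otimes> (q * (w * \<sigma> u2) * c)) z) u"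
        by (simp only: mult.assoc)
      also have "\<dots> = (p * u) \<otimes> (q * 1 * c)"
        by (rule sw_cancel(4)) (intro lin_intros)
      finally show ?thesis by simp
    qed
    then show ?thesis by simp
  qed
  finally show ?thesis .
qed

lemma restrict_action_surj:
  fixes l r ad :: "'h \<Rightarrow> 'm::cq_vector \<Rightarrow> 'm"
  assumes "(l, r, ad) \<in> compatible_bimodules \<Delta> \<sigma>"
  shows "\<exists>act. left_module_on \<A> act \<and> restrict_action \<Delta> \<sigma> act = (l, r, ad)"
proof -
  from assms have l: "bilinear_action_on LF l" "\<And>m. l 1 m = m"
      "\<And>a b m. a \<in> LF \<Longrightarrow> b \<in> LF \<Longrightarrow> l (a * b) m = l a (l b m)"
    and r: "bilinear_action_on LF r" "\<And>m. r 1 m = m"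
      "\<And>a b m. a \<in> LF \<Longrightarrow> b \<in> LF \<Longrightarrow> r (a * b) m = r b (r a m)"
    and lr: "\<And>b c m. b \<in> LF \<Longrightarrow> c \<in> LF \<Longrightarrow> r c (l b m) = l b (r c m)"
    and ad: "bilinear_action_on UNIV ad" "\<And>m. ad 1 m = m" "\<And>a b m. ad (a * b) m = ad a (ad b m)"
    and compat1: "\<And>a b c m. b \<in> LF \<Longrightarrow> c \<in> LF \<Longrightarrow> ad a (r c (l b m)) =
      tlift (\<lambda>w a3. tlift (\<lambda>a1 a2. r (AD a3 c) (l (AD a1 b) (ad a2 m))) w) (tmap \<Delta> id (\<Delta> a))"
    and compat2: "\<And>a m ps. a \<in> LF \<Longrightarrow> set ps \<subseteq> UNIV \<times> LF \<Longrightarrow> \<Delta> a = (\<Sum>(a1, a2)\<leftarrow>ps. a1 \<otimes> a2) \<Longrightarrow>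
      (\<Sum>(a1, a2)\<leftarrow>ps. r a2 (ad a1 m)) = l a m"
    by (auto simp: compatible_bimodules_def compatible_ad_action_def bimodule_on_def
        left_module_on_def right_module_on_def)
  obtain \<pi> where \<pi>: "cq_linear \<pi>" "\<And>x. \<pi> x \<in> LF" "\<And>x. x \<in> LF \<Longrightarrow> \<pi> x = x"
    by (rule projection_exists[OF subspace_locally_finite_part[of \<Delta> \<sigma>]]) blast
  note act_intros = lin_intros action_lin_vec[OF l(1)] action_lin_vec[OF r(1)] action_lin_vec[OF ad(1)]
    action_lin_arg[OF r(1)] action_lin_arg[OF ad(1)] cq_linear_compose[OF \<pi>(1)] \<pi>(2) UNIV_I
  (* \<pi> only serves to make the lifted map bilinear; r is undefined outside of LF *)
  define act where "act z m = tlift (\<lambda>u c. r (\<pi> c) (ad u m)) (unpsi z)" for z m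
  have lin: "cq_linear (\<lambda>z. act (g z) m)" if "cq_linear g" for g :: "('h, 'h op) tensor \<Rightarrow> _" and m
    unfolding act_def unpsi_def by (intro act_intros that)
  have lin_vec: "cq_linear (\<lambda>m. act z (g m))" if "cq_linear g" for g :: "'m \<Rightarrow> 'm" and z
    unfolding act_def by (intro act_intros that)
  have base: "act ((b \<otimes> Op c) * \<psi> u) m = r c (l b (ad u m))" if bc: "b \<in> LF" "c \<in> LF" for b c u m
  proof -
    have bil: "cq_bilinear (\<lambda>u c. r (\<pi> c) (ad u m))" for m by (intro act_intros)
    have bil': "cq_bilinear (\<lambda>p q. (p * u) \<otimes> (q * c))" by (intro lin_intros)
    from comult_LF[OF bc(1)] obtain I :: "nat set" and p q where I: "finite I"
      and b: "\<Delta> b = (\<Sum>i\<in>I. p i \<otimes> q i)" and q: "\<And>i. i \<in> I \<Longrightarrow> q i \<in> LF" by blast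
    have "act ((b \<otimes> Op c) * \<psi> u) m = (\<Sum>i\<in>I. r (\<pi> (q i * c)) (ad (p i * u) m))"
      unfolding act_def unpsi_base b
      by (simp only: cq_linear_sum[OF cq_linear_tlift[OF bil']] tlift_tens[OF bil']
          cq_linear_sum[OF cq_linear_tlift[OF bil]] tlift_tens[OF bil])
    also have "\<dots> = (\<Sum>i\<in>I. r c (r (q i) (ad (p i) (ad u m))))"
      \<comment> \<open>The projection disappears because \<open>q i * c\<close> lies in F(U), and
        the right module law makes \<open>r (q i)\<close> act before \<open>r c\<close>.\<close>
      using q bc by (intro sum.cong) (simp_all add: \<pi>(3) LF_mult r ad)
    also have "\<dots> = r c (\<Sum>i\<in>I. r (q i) (ad (p i) (ad u m)))"
      by (simp add: cq_linear_sum[OF bilinear_actionD(1)[OF r(1) bc(2)]])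
    \<comment> \<open>The second compatibility condition applies to this expression of \<Delta> b,
      written as a list.\<close>
    also have "(\<Sum>i\<in>I. r (q i) (ad (p i) (ad u m))) = l b (ad u m)"
    proof -
      let ?ps = "map (\<lambda>i. (p i, q i)) (sorted_list_of_set I)"
      have "(\<Sum>(a1, a2)\<leftarrow>?ps. r a2 (ad a1 (ad u m))) = l b (ad u m)"
        using I q by (intro compat2 bc) (auto simp: b o_def sum_list_distinct_conv_sum_set)
      then show ?thesis using I by (simp add: o_def sum_list_distinct_conv_sum_set)
    qed
    finally show ?thesis .
  qed
  have mult_base: "act (z * w) m = act z (act w m)"
    if z: "z = (b \<otimes> Op c) * \<psi> u" "b \<in> LF" "c \<in> LF"
      and w: "w = (b' \<otimes> Op c') * \<psi> v" "b' \<in> LF" "c' \<in> LF" for z w b c u b' c' v m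
  proof -
    have "act (z * w) m
        = sw (\<lambda>p q. sw (\<lambda>s t. act (((b * AD p b') \<otimes> Op (AD t c' * c)) * \<psi> (s * v)) m) q) u"
      unfolding z(1) w(1) F_env_psi_base_mult by (simp only: linear_tlift[OF lin[OF cq_linear_id]])
    also have "\<dots> = sw (\<lambda>p q. sw (\<lambda>s t. r c (l b (r (AD t c') (l (AD p b') (ad s (ad v m)))))) q) u"
      \<comment> \<open>The bimodule law \<open>lr\<close> moves \<open>l b\<close> outward past
        \<open>r (AD t c')\<close>, which isolates the sum occurring in the first compatibility
        condition.\<close>
      using z w by (simp add: base LF_adj LF_mult l r ad lr)
    also have "\<dots> = r c (l b (sw (\<lambda>p q. sw (\<lambda>s t. r (AD t c') (l (AD p b') (ad s (ad v m)))) q) u))"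
      using z by (simp only: linear_tlift[OF bilinear_actionD(1)[OF l(1)]]
          linear_tlift[OF bilinear_actionD(1)[OF r(1)]])
    also have "\<dots> = r c (l b (ad u (r c' (l b' (ad v m)))))"
      by (simp only: compat1[OF w(2,3)] threefold_action[OF l(1) r(1) ad(1) w(2,3)])
    also have "\<dots> = act z (act w m)"
      using z w by (simp add: base)
    finally show ?thesis .
  qed
  have mult: "act (z * w) m = act z (act w m)" if "z \<in> \<A>" "w \<in> \<A>" for z w m
  proof -
    let ?G = "{(b \<otimes> Op c) * \<psi> u | b c u. b \<in> LF \<and> c \<in> LF}"
    \<comment> \<open>Both sides are linear in \<open>w\<close> and in \<open>z\<close>, so the
      identity passes from the spanning products to \<open>\<A>\<close> in one variable at a
      time.\<close>
    have base_left: "act (z * w) m = act z (act w m)" if z: "z \<in> ?G" for z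
    proof (rule cq_linear_eq_on_span[of "\<lambda>w. act (z * w) m" "\<lambda>w. act z (act w m)"])
      show "cq_linear (\<lambda>w. act (z * w) m)" by (intro lin lin_intros)
      show "cq_linear (\<lambda>w. act z (act w m))"
        by (rule cq_linear_compose[OF lin_vec[OF cq_linear_id] lin[OF cq_linear_id]])
      show "w \<in> cq.span ?G"
        using \<open>w \<in> \<A>\<close> by (simp only: F_env_psi_eq)
    qed (use z mult_base in blast)
    show ?thesis
    proof (rule cq_linear_eq_on_span[of "\<lambda>z. act (z * w) m" "\<lambda>z. act z (act w m)"])
      show "z \<in> cq.span ?G"
        using \<open>z \<in> \<A>\<close> by (simp only: F_env_psi_eq)
    qed (intro lin lin_intros base_left)+
  qed
  have spec: "b \<in> LF \<Longrightarrow> act (b \<otimes> 1) m = l b m" "c \<in> LF \<Longrightarrow> act (1 \<otimes> Op c) m = r c m"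
    "act (\<psi> u) m = ad u m" for b c u m
    using base[of b 1 1 m] base[of 1 c 1 m] base[of 1 1 u m]
    by (simp_all add: LF_one psi_one l(2) r(2) ad(2) flip: one_op_def one_tensor_def)
  have "left_module_on \<A> (restrict act \<A>)"
    using cq_linearD[OF lin[OF cq_linear_id]] lin_vec[OF cq_linear_id] spec(3)[of 1]
    by (simp add: left_module_on_def bilinear_action_on_def F_env_psi_gens F_env_psi_mult mult
        cq.subspace_add[OF subspace_F_env_psi] cq.subspace_scale[OF subspace_F_env_psi] psi_one ad(2))
  moreover have "restrict_action \<Delta> \<sigma> (restrict act \<A>) = (l, r, ad)"
    unfolding restrict_action_def
    by (auto simp: fun_eq_iff restrict_def F_env_psi_gens spec bilinear_actionD(4)[OF l(1)]
        bilinear_actionD(4)[OF r(1)])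
  ultimately show ?thesis by blast
qed

theorem bij_betw_restrict_action:
  "bij_betw (restrict_action \<Delta> \<sigma>)
     {act :: ('h, 'h op) tensor \<Rightarrow> 'm::cq_vector \<Rightarrow> 'm. left_module_on \<A> act}
     (compatible_bimodules \<Delta> \<sigma>)"
  unfolding bij_betw_def
proof
  show "inj_on (restrict_action \<Delta> \<sigma>) {act :: ('h, 'h op) tensor \<Rightarrow> 'm \<Rightarrow> 'm. left_module_on \<A> act}"
    by (rule inj_onI) (rule restrict_action_inj, simp_all only: mem_Collect_eq)
  show "restrict_action \<Delta> \<sigma> ` {act :: ('h, 'h op) tensor \<Rightarrow> 'm \<Rightarrow> 'm. left_module_on \<A> act}
      = compatible_bimodules \<Delta> \<sigma>"
  proof (intro antisym subsetI)
    fix x :: "('h \<Rightarrow> 'm \<Rightarrow> 'm) \<times> ('h \<Rightarrow> 'm \<Rightarrow> 'm) \<times> ('h \<Rightarrow> 'm \<Rightarrow> 'm)"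
    assume x: "x \<in> compatible_bimodules \<Delta> \<sigma>"
    obtain l r ad where lrad: "x = (l, r, ad)" by (rule prod_cases3)
    obtain act where "left_module_on \<A> act" "restrict_action \<Delta> \<sigma> act = (l, r, ad)"
      using restrict_action_surj[OF x[unfolded lrad]] by (elim exE conjE)
    then show "x \<in> restrict_action \<Delta> \<sigma> ` {act. left_module_on \<A> act}"
      unfolding lrad by (intro image_eqI[of _ _ act]) simp_all
  qed (auto simp only: restrict_action_compatible mem_Collect_eq)
qed

end

section \<open>Bijectivity of the antipode\<close>

lemma qvar_nonzero: "qvar \<noteq> 0"
  by (simp add: qvar_def Zero_fract_def eq_fract)

lemma free_eval_add: "free_eval g (z + w) = free_eval g z + free_eval g w"
  by (simp add: free_eval_def lin_ext_add)

lemma free_eval_zero: "free_eval g 0 = 0"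
  by (simp add: free_eval_def)

lemma free_eval_diff: "free_eval g (z - w) = free_eval g z - free_eval g w"
  by (simp add: free_eval_def lin_ext_diff)

lemma free_eval_const: "free_eval g (free_const c) = c *\<^sub>q 1"
  by (simp add: free_eval_def free_const_def zero_free_monoid_def)

lemma free_eval_gen: "free_eval g (free_gen x) = g x"
  by (simp add: free_eval_def free_gen_def scaleq_one)

lemma free_eval_one: "free_eval g 1 = 1"
  using free_eval_const[of g 1] by (simp add: free_const_def scaleq_one)

lemma free_eval_mult: "free_eval g (z * w) = free_eval g z * free_eval g w"
proof -
  have expand: "(\<Sum>k\<in>Poly_Mapping.keys p. Poly_Mapping.single k (Poly_Mapping.lookup p k)) = p"
    for p :: "'x free_monoid \<Rightarrow>\<^sub>0 ratfun"
    by (rule poly_mapping_eqI) (auto simp: lookup_sum lookup_single when_def in_keys_iff)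
  have sum: "free_eval g (\<Sum>i\<in>I. f i) = (\<Sum>i\<in>I. free_eval g (f i))" for I :: "'x free_monoid set" and f
    by (induction I rule: infinite_finite_induct) (simp_all add: free_eval_add free_eval_zero)
  have single: "free_eval g (Poly_Mapping.single k c * Poly_Mapping.single k' c')
      = free_eval g (Poly_Mapping.single k c) * free_eval g (Poly_Mapping.single k' c')" for k k' c c'
    by (simp add: mult_single free_eval_def plus_free_monoid_def mult_scaleq_left mult_scaleq_right scaleq_scaleq)
  show ?thesis
    by (subst (1 2) expand[symmetric], subst (3) expand[symmetric], subst (4) expand[symmetric])
      (simp only: sum_distrib_left sum_distrib_right sum single)
qed

lemma free_eval_power: "free_eval g (z ^ n) = free_eval g z ^ n"
  by (induction n) (simp_all add: free_eval_one free_eval_mult)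

lemma free_eval_sum: "free_eval g (\<Sum>i\<in>I. f i) = (\<Sum>i\<in>I. free_eval g (f i))"
  by (induction I rule: infinite_finite_induct) (simp_all add: free_eval_add free_eval_zero)

lemmas free_eval_simps = free_eval_add free_eval_zero free_eval_diff free_eval_const free_eval_gen
  free_eval_one free_eval_mult free_eval_power free_eval_sum

text \<open>The kernel of the evaluation is one of the ideals intersected in
  \<open>ideal_generated R\<close>; this is the universal property of the presentation.\<close>

lemma free_eval_kernel:
  assumes "\<And>z. z \<in> R \<Longrightarrow> free_eval g z = 0" "z \<in> ideal_generated R"
  shows "free_eval g z = 0"
proof -
  have "ideal_generated R \<subseteq> {z. free_eval g z = 0}"
    unfolding ideal_generated_def using assms(1) by (intro Inter_lower) (auto simp: free_eval_simps)
  with assms(2) show ?thesis by blast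
qed

lemma free_eval_in_subalgebra:
  assumes "\<And>x. P (g x)" "P 1" "\<And>a b. P a \<Longrightarrow> P b \<Longrightarrow> P (a + b)"
    "\<And>c a. P a \<Longrightarrow> P (c *\<^sub>q a)" "\<And>a b. P a \<Longrightarrow> P b \<Longrightarrow> P (a * b)"
  shows "P (free_eval g z)"
proof -
  have word: "P (prod_list (map g w))" for w
    by (induction w) (simp_all add: assms)
  have "P 0" using assms(4)[OF assms(2), of 0] by simp
  then have "P (\<Sum>w\<in>S. Poly_Mapping.lookup z w *\<^sub>q prod_list (map g (letters w)))" for S
    by (induction S rule: infinite_finite_induct) (simp_all add: assms word)
  then show ?thesis by (simp add: free_eval_def lin_ext_def)
qed

lemma power_scaleq: "(c *\<^sub>q (a :: 'a::cq_algebra)) ^ n = c ^ n *\<^sub>q a ^ n"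
  by (induction n) (simp_all add: scaleq_one mult_scaleq_left mult_scaleq_right scaleq_scaleq)

section \<open>Relations of U and the square of its antipode\<close>

context quantized_enveloping_algebra
begin

abbreviation eval_gens :: "('i \<Rightarrow> 'u) \<Rightarrow> ('i \<Rightarrow> 'u) \<Rightarrow> 'i uq_gen free_algebra \<Rightarrow> 'u" where
  "eval_gens x' y' \<equiv> free_eval (uq_assign x' y' t t')"

lemma gen_induct:
  assumes "\<And>i. P (x i)" "\<And>i. P (y i)" "\<And>i. P (t i)" "\<And>i. P (t' i)" "P 1"
    "\<And>a b. P a \<Longrightarrow> P b \<Longrightarrow> P (a + b)" "\<And>c a. P a \<Longrightarrow> P (c *\<^sub>q a)" "\<And>a b. P a \<Longrightarrow> P b \<Longrightarrow> P (a * b)"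
  shows "P u"
proof -
  have "P (uq_assign x y t t' g)" for g by (cases g) (simp_all add: assms)
  then have "P (eval_gens x y z)" for z by (rule free_eval_in_subalgebra) (simp_all add: assms)
  moreover have "surj (eval_gens x y)" using presentation by (simp add: presented_by_def)
  ultimately show ?thesis by (metis surjD)
qed

lemma relator_zero: "z \<in> uq_relators ip \<Longrightarrow> eval_gens x y z = 0"
  using presentation by (auto simp: presented_by_def ideal_generated_def)

lemma relations:
  "x i * y j - y j * x i = (if i = j then (1 / (q_i ip i - inverse (q_i ip i))) *\<^sub>q (t i - t' i) else 0)"
  "t i * t' i = 1" "t' i * t i = 1" "t i * t j = t j * t i"
  "t i * x j = qvar powi ip i j *\<^sub>q (x j * t i)"
  "t i * y j = qvar powi (- ip i j) *\<^sub>q (y j * t i)"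
proof -
  let ?X = "\<lambda>i. free_gen (GX i)" and ?Y = "\<lambda>i. free_gen (GY i)"
    and ?T = "\<lambda>i. free_gen (GT i)" and ?T' = "\<lambda>i. free_gen (GTinv i)"
  have 1: "?X i * ?Y j - ?Y j * ?X i - (if i = j then free_const (1 / (q_i ip i - inverse (q_i ip i))) * (?T i - ?T' i) else 0)
      \<in> uq_relators ip"
    unfolding uq_relators_def Let_def by blast
  have 2: "?T i * ?T' i - 1 \<in> uq_relators ip" "?T' i * ?T i - 1 \<in> uq_relators ip"
    "?T i * ?T j - ?T j * ?T i \<in> uq_relators ip"
    "?T i * ?X j - free_const (qvar powi ip i j) * ?X j * ?T i \<in> uq_relators ip"
    "?T i * ?Y j - free_const (qvar powi (- ip i j)) * ?Y j * ?T i \<in> uq_relators ip"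
    unfolding uq_relators_def Let_def by blast+
  show "x i * y j - y j * x i = (if i = j then (1 / (q_i ip i - inverse (q_i ip i))) *\<^sub>q (t i - t' i) else 0)"
    using relator_zero[OF 1] by (simp add: free_eval_simps mult_scaleq_left split: if_splits)
  show "t i * t' i = 1" "t' i * t i = 1" "t i * t j = t j * t i"
    "t i * x j = qvar powi ip i j *\<^sub>q (x j * t i)"
    "t i * y j = qvar powi (- ip i j) *\<^sub>q (y j * t i)"
    using 2[THEN relator_zero] by (simp_all add: free_eval_simps mult_scaleq_left)
qed

lemma eval_serre:
  "free_eval g (serre_element ip z i j) =
    (let N = nat (1 - cartan_entry ip i j) in
      \<Sum>m\<le>N. ((-1) ^ m * qbinom (q_i ip i) N m) *\<^sub>q (free_eval g (z i) ^ (N - m) * free_eval g (z j) * free_eval g (z i) ^ m))"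
  by (simp add: serre_element_def Let_def free_eval_simps mult_scaleq_left)

text \<open>The Serre element is homogeneous: each term has degree N = 1 - a_ij in the i-th
  generator and degree 1 in the j-th.\<close>

lemma eval_serre_scale:
  assumes "\<And>i. free_eval g (z i) = c i *\<^sub>q free_eval g' (z i)"
  shows "free_eval g (serre_element ip z i j)
    = (c i ^ nat (1 - cartan_entry ip i j) * c j) *\<^sub>q free_eval g' (serre_element ip z i j)"
proof -
  have "(c i ^ (N - m) *\<^sub>q a ^ (N - m)) * (c j *\<^sub>q b) * (c i ^ m *\<^sub>q a ^ m) = (c i ^ N * c j) *\<^sub>q (a ^ (N - m) * b * a ^ m)"
    if "m \<le> N" for N m and a b :: 'a
  proof -
    have "c i ^ N = c i ^ (N - m) * c i ^ m" using that by (simp flip: power_add)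
    then show ?thesis by (simp add: mult_scaleq_left mult_scaleq_right scaleq_scaleq mult_ac)
  qed
  then show ?thesis
    unfolding eval_serre Let_def assms power_scaleq
    by (simp add: cq.scale_sum_right scaleq_scaleq mult_ac)
qed

text \<open>The relation between x_i and y_j survives because the two scalars cancel for i = j and
  its right side is 0 otherwise. The other relations are homogeneous in the x's or in the y's, or
  involve neither.\<close>

lemma scaled_gens_relator:
  assumes c: "\<And>i. c i \<noteq> 0" and z: "z \<in> uq_relators ip"
  shows "eval_gens (\<lambda>i. c i *\<^sub>q x i) (\<lambda>i. inverse (c i) *\<^sub>q y i) z = 0"
proof -
  have serre_x: "eval_gens x y (serre_element ip (\<lambda>i. free_gen (GX i)) i j) = 0" if "i \<noteq> j" for i j
    by (rule relator_zero) (use that in \<open>unfold uq_relators_def Let_def, blast\<close>)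
  have serre_y: "eval_gens x y (serre_element ip (\<lambda>i. free_gen (GY i)) i j) = 0" if "i \<noteq> j" for i j
    by (rule relator_zero) (use that in \<open>unfold uq_relators_def Let_def, blast\<close>)
  let ?e = "eval_gens (\<lambda>i. c i *\<^sub>q x i) (\<lambda>i. inverse (c i) *\<^sub>q y i)"
  have X: "?e (serre_element ip (\<lambda>i. free_gen (GX i)) i j) = 0" if "i \<noteq> j" for i j
    by (subst eval_serre_scale[where c = c and g' = "uq_assign x y t t'"])
      (simp_all add: free_eval_gen serre_x[OF that])
  have Y: "?e (serre_element ip (\<lambda>i. free_gen (GY i)) i j) = 0" if "i \<noteq> j" for i j
    by (subst eval_serre_scale[where c = "\<lambda>i. inverse (c i)" and g' = "uq_assign x y t t'"])
      (simp_all add: free_eval_gen serre_y[OF that])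
  have XY: "c i *\<^sub>q x i * inverse (c j) *\<^sub>q y j - inverse (c j) *\<^sub>q y j * c i *\<^sub>q x i
      = (if i = j then (1 / (q_i ip i - inverse (q_i ip i))) *\<^sub>q (t i - t' i) else 0)" for i j
  proof -
    have "c i *\<^sub>q x i * inverse (c j) *\<^sub>q y j - inverse (c j) *\<^sub>q y j * c i *\<^sub>q x i
        = (c i * inverse (c j)) *\<^sub>q (x i * y j - y j * x i)"
      by (simp add: mult_scaleq_left mult_scaleq_right scaleq_scaleq mult.commute cq.scale_right_diff_distrib)
    then show ?thesis unfolding relations(1) using c by (simp add: scaleq_one)
  qed
  have XY_eval: "?e (free_gen (GX i) * free_gen (GY j) - free_gen (GY j) * free_gen (GX i) -
      (if i = j then free_const (1 / (q_i ip i - inverse (q_i ip i))) * (free_gen (GT i) - free_gen (GTinv i)) else 0)) = 0"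
    for i j
    unfolding free_eval_simps uq_assign.simps XY by (simp add: free_eval_simps mult_scaleq_left)
  show ?thesis
    using z unfolding uq_relators_def Let_def
    by (elim UnE CollectE exE conjE, simp only: XY_eval)
      (simp_all add: free_eval_simps X Y relations mult_scaleq_left mult_scaleq_right scaleq_scaleq
        mult.commute[of "_ :: ratfun"] cq.scale_right_diff_distrib)
qed

text \<open>The factor q^(\<alpha>_i, \<alpha>_i) = q_i^2 arising when t_i is moved past
  x_i.\<close>

abbreviation scaling :: "'i \<Rightarrow> ratfun" where
  "scaling i \<equiv> qvar powi ip i i"

text \<open>Applying the antipode twice sends x_i to t_i^-1 x_i t_i and y_i to t_i^-1 y_i t_i; the
  commutation relations turn these conjugations into scalars.\<close>

lemma antipode_square:
  "\<sigma> (\<sigma> (t i)) = t i" "\<sigma> (\<sigma> (t' i)) = t' i"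
  "\<sigma> (\<sigma> (x i)) = inverse (scaling i) *\<^sub>q x i" "\<sigma> (\<sigma> (y i)) = scaling i *\<^sub>q y i"
proof -
  have q: "scaling i \<noteq> 0" using qvar_nonzero by simp
  show "\<sigma> (\<sigma> (t i)) = t i" "\<sigma> (\<sigma> (t' i)) = t' i" by (simp_all add: antipode_t)
  have "x i = t' i * (t i * x i)" by (simp add: relations(3) flip: mult.assoc)
  then have "x i = scaling i *\<^sub>q (t' i * x i * t i)"
    by (simp add: relations(5) mult_scaleq_right mult.assoc)
  then have "inverse (scaling i) *\<^sub>q x i = t' i * x i * t i"
    using q by (metis scaleq_scaleq left_inverse scaleq_one)
  then show "\<sigma> (\<sigma> (x i)) = inverse (scaling i) *\<^sub>q x i"
    by (simp add: antipode_x antipode_mult antipode_t cq_linearD[OF antipode_linear])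
  have "y i = t' i * (t i * y i)" by (simp add: relations(3) flip: mult.assoc)
  then have "y i = inverse (scaling i) *\<^sub>q (t' i * y i * t i)"
    by (simp add: relations(6) mult_scaleq_right mult.assoc power_int_minus)
  then have "scaling i *\<^sub>q y i = t' i * y i * t i"
    using q by (metis scaleq_scaleq right_inverse scaleq_one)
  then show "\<sigma> (\<sigma> (y i)) = scaling i *\<^sub>q y i"
    by (simp add: antipode_y antipode_mult antipode_t cq_linearD[OF antipode_linear] mult.assoc)
qed

text \<open>The square of the antipode rescales the generators, and the inverse rescaling respects the
  relations, hence is an endomorphism inverting it.\<close>

lemma inj_antipode_square: "inj (\<lambda>u. \<sigma> (\<sigma> u))"
proof -
  let ?e = "eval_gens x y"
  let ?e' = "eval_gens (\<lambda>i. scaling i *\<^sub>q x i) (\<lambda>i. inverse (scaling i) *\<^sub>q y i)"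
  note lin = cq_linearD[OF antipode_linear]
  have q: "scaling i \<noteq> 0" for i using qvar_nonzero by simp
  \<comment> \<open>One \<open>z\<close> serves both evaluations: \<open>?e z\<close> is \<sigma>^2
    u while the rescaled \<open>?e' z\<close> returns \<open>u\<close>. This expresses that the
    rescaling inverts \<sigma>^2 without building it as a map on U.\<close>
  have lift: "\<exists>z. ?e z = \<sigma> (\<sigma> u) \<and> ?e' z = u" for u
  proof (induction u rule: gen_induct)
    case (1 i)
    show ?case
      by (rule exI[of _ "free_const (inverse (scaling i)) * free_gen (GX i)"])
        (simp add: free_eval_simps antipode_square mult_scaleq_left scaleq_scaleq scaleq_one qvar_nonzero)
  next
    case (2 i)
    show ?case
      by (rule exI[of _ "free_const (scaling i) * free_gen (GY i)"])
        (simp add: free_eval_simps antipode_square mult_scaleq_left scaleq_scaleq scaleq_one qvar_nonzero)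
  next
    case (3 i)
    show ?case by (rule exI[of _ "free_gen (GT i)"]) (simp add: free_eval_simps antipode_square)
  next
    case (4 i)
    show ?case by (rule exI[of _ "free_gen (GTinv i)"]) (simp add: free_eval_simps antipode_square)
  next
    case 5
    show ?case by (rule exI[of _ 1]) (simp add: free_eval_simps antipode_one)
  next
    case (6 a b)
    then obtain z w where "?e z = \<sigma> (\<sigma> a)" "?e' z = a" "?e w = \<sigma> (\<sigma> b)" "?e' w = b" by blast
    then show ?case by (intro exI[of _ "z + w"]) (simp add: free_eval_simps lin)
  next
    case (7 c a)
    then obtain z where "?e z = \<sigma> (\<sigma> a)" "?e' z = a" by blast
    then show ?case
      by (intro exI[of _ "free_const c * z"]) (simp add: free_eval_simps lin mult_scaleq_left)
  next
    case (8 a b)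
    then obtain z w where "?e z = \<sigma> (\<sigma> a)" "?e' z = a" "?e w = \<sigma> (\<sigma> b)" "?e' w = b" by blast
    then show ?case by (intro exI[of _ "z * w"]) (simp add: free_eval_simps antipode_mult)
  qed
  \<comment> \<open>The rescaled generators satisfy the defining relations, so \<open>?e'\<close>
    vanishes on the kernel of \<open>?e\<close>.\<close>
  have vanish: "?e' z = 0" if "?e z = 0" for z
  proof (rule free_eval_kernel)
    show "z \<in> ideal_generated (uq_relators ip)"
      using that presentation unfolding presented_by_def by blast
  qed (rule scaled_gens_relator[OF q])
  have kernel: "u = 0" if "\<sigma> (\<sigma> u) = 0" for u
  proof -
    obtain z where "?e z = \<sigma> (\<sigma> u)" "?e' z = u" using lift[of u] by (elim exE conjE)
    then show ?thesis using vanish[of z] that by simp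
  qed
  show ?thesis
  proof (rule injI)
    fix u v assume "\<sigma> (\<sigma> u) = \<sigma> (\<sigma> v)"
    then show "u = v" using kernel[of "u - v"] by (simp add: lin)
  qed
qed

text \<open>The range is closed under products because the antipode reverses them. Preimages of x_i
  and y_i are read off from \<open>antipode_square\<close>, while t_i and its inverse are
  exchanged.\<close>

lemma surj_antipode: "surj \<sigma>"
proof -
  note lin = cq_linearD[OF antipode_linear]
  have q: "scaling i \<noteq> 0" for i using qvar_nonzero by simp
  have "\<exists>v. \<sigma> v = u" for u
  proof (induction u rule: gen_induct)
    case (1 i)
    show ?case
      by (rule exI[of _ "scaling i *\<^sub>q \<sigma> (x i)"]) (simp add: lin antipode_square scaleq_scaleq scaleq_one qvar_nonzero)
  next
    case (2 i)
    show ?case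
      by (rule exI[of _ "inverse (scaling i) *\<^sub>q \<sigma> (y i)"]) (simp add: lin antipode_square scaleq_scaleq scaleq_one qvar_nonzero)
  next
    case (6 a b)
    then show ?case by (metis lin(1))
  next
    case (7 c a)
    then show ?case by (metis lin(2))
  next
    case (8 a b)
    then show ?case by (metis antipode_mult)
  qed (metis antipode_t antipode_one)+
  then show ?thesis by (metis surjI)
qed

lemma bij_antipode_uq: "bij \<sigma>"
proof (rule bijI[OF _ surj_antipode])
  show "inj \<sigma>" using inj_antipode_square by (auto simp: inj_def)
qed

end

theorem theorem5p5:
  fixes scale :: "complex \<Rightarrow> 'g::ab_group_add \<Rightarrow> 'g"
    and br :: "'g \<Rightarrow> 'g \<Rightarrow> 'g"
    and h :: "'g set"
    and \<alpha> :: "'i::finite \<Rightarrow> 'g \<Rightarrow> complex"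
    and ip :: "'i \<Rightarrow> 'i \<Rightarrow> int"
    and \<Delta> :: "'u::cq_algebra \<Rightarrow> ('u, 'u) tensor"
    and \<epsilon> :: "'u \<Rightarrow> ratfun"
    and \<sigma> :: "'u \<Rightarrow> 'u"
    and x y t t' :: "'i \<Rightarrow> 'u"
  assumes "quantized_enveloping_algebra scale br \<Delta> \<epsilon> \<sigma> h \<alpha> ip x y t t'"
  shows "bij_betw (restrict_action \<Delta> \<sigma>)
           {act :: ('u, 'u op) tensor \<Rightarrow> 'm::cq_vector \<Rightarrow> 'm. left_module_on (F_env_psi \<Delta> \<sigma>) act}
           (compatible_bimodules \<Delta> \<sigma>)"
proof -
  interpret quantized_enveloping_algebra scale br \<Delta> \<epsilon> \<sigma> h \<alpha> ip x y t t' by (rule assms)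
  interpret bijective_hopf_algebra \<Delta> \<epsilon> \<sigma> by standard (rule bij_antipode_uq)
  show ?thesis by (rule bij_betw_restrict_action)
qed

end
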